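(* Let $V$ be a vertex operator algebra of class $\mathcal{A}$, i.e. such that $L(0)$ acts semisimply on every weak $V$-module. Then $V$ satisfies the $C_2$-finiteness condition, i.e. $\dim V/C_2(V)<\infty$, and $V$ is finitely generated as a vertex operator algebra. In particular, any regular vertex operator algebra satisfies the $C_2$-finiteness condition and is finitely generated.
   Context: All vector spaces are over $\mathbb{C}$. A vertex operator algebra $V=\coprod_{n\in\mathbb{Z}}V_{(n)}$ is meant in the standard sense of Frenkel–Huang–Lepowsky: vertex operators $Y(v,x)=\sum_{n\in\mathbb{Z}}v_nx^{-n-1}$, vacuum $\mathbf{1}$, Virasoro vector $\omega$ with $Y(\omega,x)=\sum_n L(n)x^{-n-2}$, $V_{(n)}$ is the $L(0)$-eigenspace of eigenvalue $n$, $\dim V_{(n)}<\infty$, and $V_{(n)}=0$ for $n$ sufficiently negative. A weak $V$-module is a vector space $W$ with a linear map $Y_W:V\to(\mathrm{End}\,W)[[x,x^{-1}]]$, $Y_W(v,x)=\sum_n v_nx^{-n-1}$, satisfying $Y_W(v,x)w\in W((x))$, $Y_W(\mathbf{1},x)=\mathrm{id}_W$ and the Jacobi identity (no grading is required). A (ordinary) $V$-module is a weak $V$-module $W=\coprod_{h\in\mathbb{C}}W_{(h)}$ graded by $L(0)$-eigenspaces with $\dim W_{(h)}<\infty$ and, for each $h\in\mathbb{C}$, $W_{(h+n)}=0$ for all sufficiently negative integers $n$. $V$ is regular if every weak $V$-module is a direct sum of irreducible (ordinary) $V$-modules. $C_2(V)$ is the linear span of all $u_{-2}v$ with $u,v\in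 V$. $V$ is finitely generated if there is a finite subset $S\subseteq V$ such that $V$ is linearly spanned by the elements $u^1_{n_1}\cdots u^r_{n_r}\mathbf{1}$ with $r\ge 0$, $u^i\in S$, $n_i\in\mathbb{Z}$. *)

theory Defs
  imports Complex_Main "HOL-Library.Function_Algebras" "HOL-Library.Groups_Big_Fun"
begin

section \<open>Linear algebra\<close>

text \<open>
  Complex vector spaces are given by a scalar multiplication \<open>s\<close> satisfying
  \<^term>\<open>vector_space (s :: complex \<Rightarrow> 'w \<Rightarrow> 'w::ab_group_add)\<close>; the spaces under consideration may be
  proper subspaces of the ambient type.
\<close>

definition finite_dim :: "(complex \<Rightarrow> 'w \<Rightarrow> 'w) \<Rightarrow> 'w::ab_group_add set \<Rightarrow> bool"
  where "finite_dim s W \<longleftrightarrow> (\<exists>B. finite B \<and> module.span s B = W)"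

text \<open>The quotient of the ambient space by \<open>C\<close>, as the set of cosets of \<open>C\<close>, is finite-dimensional:
  it is the set of classes of linear combinations of finitely many vectors.\<close>

definition finite_dim_quotient :: "(complex \<Rightarrow> 'w \<Rightarrow> 'w) \<Rightarrow> 'w::ab_group_add set \<Rightarrow> bool"
  where "finite_dim_quotient s C \<longleftrightarrow>
    (\<exists>B. finite B \<and> range (\<lambda>v. (+) v ` C) = (\<lambda>v. (+) v ` C) ` module.span s B)"

definition direct_sum ::
  "(complex \<Rightarrow> 'w \<Rightarrow> 'w) \<Rightarrow> 'w::ab_group_add set \<Rightarrow> 'i set \<Rightarrow> ('i \<Rightarrow> 'w set) \<Rightarrow> bool"
  where "direct_sum s W I M \<longleftrightarrow>
    (\<forall>i\<in>I. module.subspace s (M i)) \<and>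
    module.span s (\<Union>i\<in>I. M i) = W \<and>
    (\<forall>J f. finite J \<and> J \<subseteq> I \<and> (\<forall>i\<in>J. f i \<in> M i) \<and> (\<Sum>i\<in>J. f i) = 0 \<longrightarrow> (\<forall>i\<in>J. f i = 0))"


section \<open>Vertex operators\<close>

text \<open>
  A vertex operator map is encoded by its modes: \<open>Y v n\<close> is the coefficient \<open>v\<^sub>n\<close> of \<open>x\<^sup>-\<^sup>n\<^sup>-\<^sup>1\<close> in \<open>Y(v,x)\<close>.
  The next definition is the Jacobi identity
  \[ x_0^{-1}\delta\Bigl(\frac{x_1-x_2}{x_0}\Bigr) Y(u,x_1)Y(v,x_2)w
   - x_0^{-1}\delta\Bigl(\frac{x_2-x_1}{-x_0}\Bigr) Y(v,x_2)Y(u,x_1)w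
   = x_2^{-1}\delta\Bigl(\frac{x_1-x_0}{x_2}\Bigr) Y(Y(u,x_0)v,x_2)w, \]
  read off at each monomial \<open>x\<^sub>0\<^sup>-\<^sup>l\<^sup>-\<^sup>1 x\<^sub>1\<^sup>-\<^sup>m\<^sup>-\<^sup>1 x\<^sub>2\<^sup>-\<^sup>n\<^sup>-\<^sup>1\<close>. On the right-hand side the binomial expansion gives
  the coefficient \<open>(-1)\<^sup>i\<close> times \<open>-m-1+i\<close> over \<open>i\<close>, which is \<open>m\<close> over \<open>i\<close>. All the sums have only finitely
  many nonzero terms when the truncation condition holds.
\<close>

definition jacobi_identity ::
  "('v \<Rightarrow> int \<Rightarrow> 'v \<Rightarrow> 'v) \<Rightarrow> (complex \<Rightarrow> 'w \<Rightarrow> 'w) \<Rightarrow> 'w::ab_group_add set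
    \<Rightarrow> ('v \<Rightarrow> int \<Rightarrow> 'w \<Rightarrow> 'w) \<Rightarrow> bool"
  where "jacobi_identity Y sW W YW \<longleftrightarrow>
    (\<forall>u v. \<forall>w\<in>W. \<forall>l m n :: int.
      Sum_any (\<lambda>i::nat. sW ((-1) ^ i * (of_int l gchoose i))
          (YW u (m + l - int i) (YW v (n + int i) w)))
      - Sum_any (\<lambda>i::nat. sW ((-1) powi l * (-1) ^ i * (of_int l gchoose i))
          (YW v (n + l - int i) (YW u (m + int i) w)))
      = Sum_any (\<lambda>i::nat. sW (of_int m gchoose i)
          (YW (Y u (l + int i) v) (m + n - int i) w)))"

definition vertex_action ::
  "(complex \<Rightarrow> 'v \<Rightarrow> 'v) \<Rightarrow> ('v \<Rightarrow> int \<Rightarrow> 'v \<Rightarrow> 'v) \<Rightarrow> 'v::ab_group_add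
    \<Rightarrow> (complex \<Rightarrow> 'w \<Rightarrow> 'w) \<Rightarrow> 'w::ab_group_add set \<Rightarrow> ('v \<Rightarrow> int \<Rightarrow> 'w \<Rightarrow> 'w) \<Rightarrow> bool"
  where "vertex_action sV Y vac sW W YW \<longleftrightarrow>
    (\<forall>v n. \<forall>w\<in>W. YW v n w \<in> W) \<and>
    (\<forall>v n. \<forall>w\<in>W. \<forall>w'\<in>W. YW v n (w + w') = YW v n w + YW v n w') \<and>
    (\<forall>v n c. \<forall>w\<in>W. YW v n (sW c w) = sW c (YW v n w)) \<and>
    (\<forall>u v n. \<forall>w\<in>W. YW (u + v) n w = YW u n w + YW v n w) \<and>
    (\<forall>v n c. \<forall>w\<in>W. YW (sV c v) n w = sW c (YW v n w)) \<and>
    (\<forall>v. \<forall>w\<in>W. \<exists>N. \<forall>n\<ge>N. YW v n w = 0) \<and>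
    (\<forall>n. \<forall>w\<in>W. YW vac n w = (if n = -1 then w else 0)) \<and>
    jacobi_identity Y sW W YW"

text \<open>\<open>Y(\<omega>,x) = \<Sum> L(n) x\<^sup>-\<^sup>n\<^sup>-\<^sup>2\<close>, hence \<open>L(n) = \<omega>\<^sub>n\<^sub>+\<^sub>1\<close>.\<close>

definition Lop :: "('v \<Rightarrow> int \<Rightarrow> 'w \<Rightarrow> 'w) \<Rightarrow> 'v \<Rightarrow> int \<Rightarrow> 'w \<Rightarrow> 'w"
  where "Lop YW \<omega> n = YW \<omega> (n + 1)"

definition L0_eigenspace ::
  "(complex \<Rightarrow> 'w \<Rightarrow> 'w) \<Rightarrow> 'w set \<Rightarrow> ('v \<Rightarrow> int \<Rightarrow> 'w \<Rightarrow> 'w) \<Rightarrow> 'v \<Rightarrow> complex \<Rightarrow> 'w set"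
  where "L0_eigenspace sW W YW \<omega> h = {w \<in> W. Lop YW \<omega> 0 w = sW h w}"


section \<open>Vertex operator algebras\<close>

locale vertex_operator_algebra = vector_space sV
  for sV :: "complex \<Rightarrow> 'v::ab_group_add \<Rightarrow> 'v" +
  fixes Y :: "'v \<Rightarrow> int \<Rightarrow> 'v \<Rightarrow> 'v" and vac \<omega> :: 'v
  assumes action: "vertex_action sV Y vac sV UNIV Y"
    and creation: "n \<ge> 0 \<Longrightarrow> Y v n vac = 0" "Y v (-1) vac = v"
    and virasoro: "\<exists>c::complex. \<forall>m n w.
          Lop Y \<omega> m (Lop Y \<omega> n w) - Lop Y \<omega> n (Lop Y \<omega> m w) =
            sV (of_int (m - n)) (Lop Y \<omega> (m + n) w)
            + (if m + n = 0 then sV (of_int (m ^ 3 - m) / 12 * c) w else 0)"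
    and L_minus_1_derivative: "Y (Lop Y \<omega> (-1) v) n w = sV (- of_int n) (Y v (n - 1) w)"
    and grading: "direct_sum sV UNIV (UNIV :: int set) (\<lambda>n. L0_eigenspace sV UNIV Y \<omega> (of_int n))"
    and vac_weight: "vac \<in> L0_eigenspace sV UNIV Y \<omega> 0"
    and conformal_weight: "\<omega> \<in> L0_eigenspace sV UNIV Y \<omega> 2"
    and finite_dim_weight_spaces: "finite_dim sV (L0_eigenspace sV UNIV Y \<omega> (of_int (n::int)))"
    and lower_truncation: "\<exists>N::int. \<forall>n<N. L0_eigenspace sV UNIV Y \<omega> (of_int n) = {0}"

definition C2 :: "(complex \<Rightarrow> 'v \<Rightarrow> 'v) \<Rightarrow> ('v \<Rightarrow> int \<Rightarrow> 'v \<Rightarrow> 'v) \<Rightarrow> 'v::ab_group_add set"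
  where "C2 sV Y = module.span sV {Y u (-2) v | u v. True}"

definition C2_finite :: "(complex \<Rightarrow> 'v \<Rightarrow> 'v) \<Rightarrow> ('v \<Rightarrow> int \<Rightarrow> 'v \<Rightarrow> 'v::ab_group_add) \<Rightarrow> bool"
  where "C2_finite sV Y \<longleftrightarrow> finite_dim_quotient sV (C2 sV Y)"

text \<open>The list \<open>[(u\<^sup>1,n\<^sub>1),\<dots>,(u\<^sup>r,n\<^sub>r)]\<close> stands for the vector \<open>u\<^sup>1\<^bsub>n\<^sub>1\<^esub> \<cdots> u\<^sup>r\<^bsub>n\<^sub>r\<^esub> 1\<close>.\<close>

definition finitely_generated ::
  "(complex \<Rightarrow> 'v \<Rightarrow> 'v) \<Rightarrow> ('v \<Rightarrow> int \<Rightarrow> 'v \<Rightarrow> 'v) \<Rightarrow> 'v::ab_group_add \<Rightarrow> bool"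
  where "finitely_generated sV Y vac \<longleftrightarrow>
    (\<exists>S. finite S \<and>
      module.span sV {foldr (\<lambda>(u, n) w. Y u n w) us vac | us. fst ` set us \<subseteq> S} = UNIV)"


section \<open>Modules\<close>

text \<open>The module is the subspace \<open>W\<close> of the ambient space; the values of \<open>YW v n\<close> outside \<open>W\<close> are
  irrelevant. In particular submodules are modules with the same \<open>YW\<close>.\<close>

locale weak_module =
  vertex_operator_algebra sV Y vac \<omega> + W: vector_space sW
  for sV :: "complex \<Rightarrow> 'v::ab_group_add \<Rightarrow> 'v"
    and Y :: "'v \<Rightarrow> int \<Rightarrow> 'v \<Rightarrow> 'v" and vac \<omega> :: 'v
    and sW :: "complex \<Rightarrow> 'w::ab_group_add \<Rightarrow> 'w" +
  fixes W :: "'w set" and YW :: "'v \<Rightarrow> int \<Rightarrow> 'w \<Rightarrow> 'w"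
  assumes subspace_W: "module.subspace sW W"
    and module_action: "vertex_action sV Y vac sW W YW"

locale ordinary_module = weak_module +
  assumes module_grading: "direct_sum sW W (UNIV :: complex set) (L0_eigenspace sW W YW \<omega>)"
    and module_finite_dim: "finite_dim sW (L0_eigenspace sW W YW \<omega> h)"
    and module_lower_truncation:
      "\<exists>N::int. \<forall>n<N. L0_eigenspace sW W YW \<omega> (h + of_int n) = {0}"

definition irreducible_action ::
  "(complex \<Rightarrow> 'w \<Rightarrow> 'w) \<Rightarrow> 'w::ab_group_add set \<Rightarrow> ('v \<Rightarrow> int \<Rightarrow> 'w \<Rightarrow> 'w) \<Rightarrow> bool"
  where "irreducible_action sW W YW \<longleftrightarrow> W \<noteq> {0} \<and>
    (\<forall>M. M \<subseteq> W \<and> module.subspace sW M \<and> (\<forall>v n. \<forall>w\<in>M. YW v n w \<in> M) \<longrightarrow> M = {0} \<or> M = W)"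

definition L0_semisimple ::
  "(complex \<Rightarrow> 'w \<Rightarrow> 'w) \<Rightarrow> 'w::ab_group_add set \<Rightarrow> ('v \<Rightarrow> int \<Rightarrow> 'w \<Rightarrow> 'w) \<Rightarrow> 'v \<Rightarrow> bool"
  where "L0_semisimple sW W YW \<omega> \<longleftrightarrow>
    direct_sum sW W (UNIV :: complex set) (L0_eigenspace sW W YW \<omega>)"

text \<open>
  HOL cannot quantify over modules of all types inside a formula, so ``every weak module'' ranges over
  the weak modules carried by subspaces of the space of all functions \<^typ>\<open>'v \<Rightarrow> complex\<close>. No generality is
  lost. If \<open>V \<noteq> 0\<close>, a submodule generated by one vector \<open>w\<close> is spanned by vectors
  \<open>u\<^sup>1\<^bsub>n\<^sub>1\<^esub> \<cdots> u\<^sup>r\<^bsub>n\<^sub>r\<^esub> w\<close>, hence has a basis of cardinality at most that of \<^typ>\<open>'v\<close>, and so is isomorphic to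
  a module of this kind (send the basis injectively to indicator functions of points of \<^typ>\<open>'v\<close>);
  if \<open>V = 0\<close>, all modules are zero. Semisimplicity of \<open>L(0)\<close> on a weak module, as well as being a
  direct sum of irreducible modules, holds as soon as it holds for all submodules generated by one
  vector (for the latter, a sum of irreducible modules is a direct sum of some of them).
\<close>

definition fun_scale :: "complex \<Rightarrow> ('a \<Rightarrow> complex) \<Rightarrow> 'a \<Rightarrow> complex"
  where "fun_scale c f = (\<lambda>x. c * f x)"

definition class_A ::
  "(complex \<Rightarrow> 'v \<Rightarrow> 'v) \<Rightarrow> ('v \<Rightarrow> int \<Rightarrow> 'v \<Rightarrow> 'v) \<Rightarrow> 'v \<Rightarrow> 'v::ab_group_add \<Rightarrow> bool"
  where "class_A sV Y vac \<omega> \<longleftrightarrow>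
    (\<forall>(W :: ('v \<Rightarrow> complex) set) YW. weak_module sV Y vac \<omega> fun_scale W YW \<longrightarrow>
      L0_semisimple fun_scale W YW \<omega>)"

definition regular ::
  "(complex \<Rightarrow> 'v \<Rightarrow> 'v) \<Rightarrow> ('v \<Rightarrow> int \<Rightarrow> 'v \<Rightarrow> 'v) \<Rightarrow> 'v \<Rightarrow> 'v::ab_group_add \<Rightarrow> bool"
  where "regular sV Y vac \<omega> \<longleftrightarrow>
    (\<forall>(W :: ('v \<Rightarrow> complex) set) YW. weak_module sV Y vac \<omega> fun_scale W YW \<longrightarrow>
      (\<exists>\<S>. direct_sum fun_scale W \<S> (\<lambda>M. M) \<and>
        (\<forall>M\<in>\<S>. ordinary_module sV Y vac \<omega> fun_scale M YW \<and> irreducible_action fun_scale M YW)))"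

end

theory Submission
  imports Defs "HOL-Computational_Algebra.Formal_Power_Series"
begin

text \<open>
  Let \<open>V\<close> act on its full linear dual by the modes \<open>v'\<^sub>n\<close> of the contragredient vertex operators, and let \<open>D\<close>
  be the space of all functionals \<open>f\<close> such that for each \<open>v\<close> one has \<open>v'\<^sub>n f = 0\<close> for large \<open>n\<close>. Then \<open>D\<close> is a weak module on
  which \<open>L(0)\<close> acts by transposition. If \<open>L(0)\<close> is semisimple on \<open>D\<close>, every \<open>f \<in> D\<close> is a finite sum of
  eigenvectors, hence vanishes on all but finitely many weight spaces. For \<open>k \<ge> 1\<close> let \<open>C\<^sub>k\<close> be the span
  of all \<open>u\<^sub>-\<^sub>k v\<close>. Functionals vanishing on \<open>C\<^sub>k\<close> lie in \<open>D\<close>, because \<open>v'\<^sub>n\<close> is the transpose of a combination of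
  modes of index at most \<open>-k\<close> when \<open>n\<close> is large. As \<open>C\<^sub>k\<close> is graded, it must contain all but finitely many
  weight spaces: otherwise functionals separating them from \<open>C\<^sub>k\<close> in infinitely many weights add up to an element
  of \<open>D\<close> with infinite support. For \<open>k = 2\<close> this is \<open>C\<^sub>2\<close>-finiteness. If \<open>k\<close> is large compared with the lowest
  weight, a homogeneous \<open>u\<^sub>-\<^sub>k v\<close> has weight greater than those of \<open>u\<close> and \<open>v\<close>, and induction on the weight
  shows that the finitely many remaining weight spaces generate \<open>V\<close>.
\<close>

section \<open>Finite sums, binomial identities and sums over index triples\<close>

lemma Sum_any_eq_sum_lessThan:
  fixes f :: "nat \<Rightarrow> 'a::comm_monoid_add"
  assumes "\<And>i. i \<ge> N \<Longrightarrow> f i = 0"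
  shows "Sum_any f = sum f {..<N}"
  by (rule Sum_any.expand_superset) (use assms linorder_not_le in auto)

lemma eventually_Sum_any_eq_sum:
  fixes f :: "nat \<Rightarrow> 'a::comm_monoid_add"
  assumes "\<And>i. i \<ge> N \<Longrightarrow> f i = 0"
  shows "\<forall>\<^sub>F I in sequentially. Sum_any f = sum f {..<I}"
  using eventually_ge_at_top[of N]
  by eventually_elim (rule Sum_any_eq_sum_lessThan, use assms in force)

text \<open>Upper negation turns the last factor into \<open>(q - z - 1) gchoose (q - i)\<close> up
  to sign, which leaves an ordinary Vandermonde convolution; a second upper negation converts its
  value back.\<close>

lemma gbinomial_alternating_Vandermonde:
  fixes m z :: "'a::field_char_0"
  shows "(\<Sum>i\<le>q. (-1) ^ i * (m gchoose i) * ((z - of_nat i) gchoose (q - i))) = (z - m) gchoose q"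
proof -
  have "(\<Sum>i\<le>q. (-1) ^ i * (m gchoose i) * ((z - of_nat i) gchoose (q - i)))
      = (\<Sum>i\<le>q. (-1) ^ q * ((m gchoose i) * ((of_nat q - z - 1) gchoose (q - i))))"
  proof (rule sum.cong[OF refl])
    fix i assume "i \<in> {..q}"
    then have i: "i \<le> q" by simp
    have "((of_nat q - z - 1) gchoose (q - i)) = (-1) ^ (q - i) * ((z - of_nat i) gchoose (q - i))"
      using gbinomial_minus[of "z + 1 - of_nat q" "q - i"] i by (simp add: of_nat_diff algebra_simps)
    moreover have "(-1) ^ q * (-1) ^ (q - i) = ((-1) ^ i :: 'a)"
    proof -
      obtain d where "q = i + d" using i le_Suc_ex by blast
      then show ?thesis by (simp add: power_add mult.assoc)
    qed
    ultimately show "(-1) ^ i * (m gchoose i) * ((z - of_nat i) gchoose (q - i))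
        = (-1) ^ q * ((m gchoose i) * ((of_nat q - z - 1) gchoose (q - i)))"
      by (simp add: mult.left_commute mult.assoc[symmetric])
  qed
  also have "\<dots> = (-1) ^ q * ((m + (of_nat q - z - 1)) gchoose q)"
    by (simp add: sum_distrib_left[symmetric] gbinomial_Vandermonde[symmetric] atMost_atLeast0)
  also have "\<dots> = (z - m) gchoose q"
    using gbinomial_minus[of "m - z" q] by (simp add: algebra_simps)
  finally show ?thesis .
qed

lemma gbinomial_of_nat_eq_0:
  assumes "n < k"
  shows "((of_nat n :: 'a::field_char_0) gchoose k) = 0"
  using assms by (simp add: binomial_gbinomial[symmetric] binomial_eq_0)

text \<open>Index set of the degree \<open>s\<close> coefficient of a product of three power series
  in one variable.\<close>

definition triples :: "nat \<Rightarrow> (nat \<times> nat \<times> nat) set"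
  where "triples s = {(j, k, p). j + k + p = s}"

lemma finite_triples [simp]: "finite (triples s)"
  by (rule finite_subset[of _ "{..s} \<times> {..s} \<times> {..s}"]) (auto simp: triples_def)

lemma sum_triples_Suc_fst:
  fixes g :: "nat \<Rightarrow> nat \<Rightarrow> nat \<Rightarrow> 'a::comm_monoid_add"
  assumes "\<And>k p. g 0 k p = 0"
  shows "(\<Sum>(j, k, p)\<in>triples (Suc s). g j k p) = (\<Sum>(j, k, p)\<in>triples s. g (Suc j) k p)"
proof -
  have "(\<Sum>(j, k, p)\<in>triples (Suc s). g j k p) = (\<Sum>(j, k, p)\<in>(\<lambda>(j, k, p). (Suc j, k, p)) ` triples s. g j k p)"
  proof (rule sum.mono_neutral_right)
    show "\<forall>t\<in>triples (Suc s) - (\<lambda>(j, k, p). (Suc j, k, p)) ` triples s. (case t of (j, k, p) \<Rightarrow> g j k p) = 0"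
    proof safe
      fix j k p assume "(j, k, p) \<in> triples (Suc s)" "(j, k, p) \<notin> (\<lambda>(j, k, p). (Suc j, k, p)) ` triples s"
      then show "g j k p = 0" using assms by (cases j) (auto simp: triples_def)
    qed
  qed (simp, auto simp: triples_def)
  also have "\<dots> = (\<Sum>(j, k, p)\<in>triples s. g (Suc j) k p)"
    by (subst sum.reindex) (auto simp: inj_on_def intro!: sum.cong)
  finally show ?thesis .
qed

lemma sum_triples_Suc_snd:
  fixes g :: "nat \<Rightarrow> nat \<Rightarrow> nat \<Rightarrow> 'a::comm_monoid_add"
  assumes "\<And>j p. g j 0 p = 0"
  shows "(\<Sum>(j, k, p)\<in>triples (Suc s). g j k p) = (\<Sum>(j, k, p)\<in>triples s. g j (Suc k) p)"
proof -
  have swap: "(\<Sum>(j, k, p)\<in>triples r. h j k p) = (\<Sum>(k, j, p)\<in>triples r. h j k p)"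
    for h :: "nat \<Rightarrow> nat \<Rightarrow> nat \<Rightarrow> 'a" and r
    by (rule sum.reindex_bij_witness[of _ "\<lambda>(k, j, p). (j, k, p)" "\<lambda>(j, k, p). (k, j, p)"])
      (auto simp: triples_def)
  show ?thesis
    using sum_triples_Suc_fst[of "\<lambda>k j p. g j k p" s] assms
    by (simp add: swap[of g] swap[of "\<lambda>j k p. g j (Suc k) p"])
qed

lemma sum_triples_Suc_third:
  fixes g :: "nat \<Rightarrow> nat \<Rightarrow> nat \<Rightarrow> 'a::comm_monoid_add"
  assumes "\<And>j k. g j k 0 = 0"
  shows "(\<Sum>(j, k, p)\<in>triples (Suc s). g j k p) = (\<Sum>(j, k, p)\<in>triples s. g j k (Suc p))"
proof -
  have swap: "(\<Sum>(j, k, p)\<in>triples r. h j k p) = (\<Sum>(p, k, j)\<in>triples r. h j k p)"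
    for h :: "nat \<Rightarrow> nat \<Rightarrow> nat \<Rightarrow> 'a" and r
    by (rule sum.reindex_bij_witness[of _ "\<lambda>(k, j, p). (p, j, k)" "\<lambda>(j, k, p). (p, k, j)"])
      (auto simp: triples_def)
  show ?thesis
    using sum_triples_Suc_fst[of "\<lambda>p k j. g j k p" s] assms
    by (simp add: swap[of g] swap[of "\<lambda>j k p. g j k (Suc p)"])
qed

section \<open>Mode identities and weights\<close>

context vertex_operator_algebra
begin

definition wspace :: "int \<Rightarrow> 'v set"
  where "wspace k = L0_eigenspace sV UNIV Y \<omega> (of_int k)"

lemma wspace_iff: "x \<in> wspace k \<longleftrightarrow> Y \<omega> 1 x = sV (of_int k) x"
  by (simp add: wspace_def L0_eigenspace_def Lop_def)

lemma Y_add_right: "Y u n (v + w) = Y u n v + Y u n w"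
  and Y_scale_right: "Y u n (sV c v) = sV c (Y u n v)"
  and Y_add_left: "Y (u + u') n v = Y u n v + Y u' n v"
  and Y_scale_left: "Y (sV c u) n v = sV c (Y u n v)"
  and Y_vac: "Y vac n v = (if n = -1 then v else 0)"
  using action by (simp_all add: vertex_action_def)

lemma Y_truncation: "\<exists>N. \<forall>n\<ge>N. Y u n v = 0"
  using action by (simp add: vertex_action_def)

lemma Y_zero_left [simp]: "Y 0 n v = 0"
  using Y_scale_left[of 0 0 n v] by simp

lemma Y_zero_right [simp]: "Y u n 0 = 0"
  using Y_scale_right[of u n 0 0] by simp

lemma Y_sum_right: "Y u n (\<Sum>i\<in>A. f i) = (\<Sum>i\<in>A. Y u n (f i))"
  by (induction A rule: infinite_finite_induct) (simp_all add: Y_add_right)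

lemma Y_sum_left: "Y (\<Sum>i\<in>A. f i) n v = (\<Sum>i\<in>A. Y (f i) n v)"
  by (induction A rule: infinite_finite_induct) (simp_all add: Y_add_left)

lemma eventually_Y_zero: "\<forall>\<^sub>F i in sequentially. Y u (n + int i) v = 0"
proof -
  obtain N where "\<forall>n\<ge>N. Y u n v = 0" using Y_truncation by blast
  then show ?thesis
    by (auto simp: eventually_sequentially intro!: exI[of _ "nat (N - n)"])
qed

text \<open>A common cutoff \<open>I\<close> replaces the three \<open>Sum_any\<close> by finite
  sums, which can be added and rearranged freely. Holding eventually lets several such identities be
  combined at one cutoff.\<close>

lemma jacobi_eventually:
  "\<forall>\<^sub>F I in sequentially.
    (\<Sum>i<I. sV ((-1) ^ i * (of_int l gchoose i)) (Y u (m + l - int i) (Y v (n + int i) w)))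
    - (\<Sum>i<I. sV ((-1) powi l * (-1) ^ i * (of_int l gchoose i)) (Y v (n + l - int i) (Y u (m + int i) w)))
    = (\<Sum>i<I. sV (of_int m gchoose i) (Y (Y u (l + int i) v) (m + n - int i) w))"
proof -
  have J: "Sum_any (\<lambda>i. sV ((-1) ^ i * (of_int l gchoose i)) (Y u (m + l - int i) (Y v (n + int i) w)))
    - Sum_any (\<lambda>i. sV ((-1) powi l * (-1) ^ i * (of_int l gchoose i)) (Y v (n + l - int i) (Y u (m + int i) w)))
    = Sum_any (\<lambda>i. sV (of_int m gchoose i) (Y (Y u (l + int i) v) (m + n - int i) w))"
    using action by (simp add: vertex_action_def jacobi_identity_def)
  obtain A where A: "\<And>i. i \<ge> A \<Longrightarrow> Y v (n + int i) w = 0"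
    using eventually_Y_zero[of v n w] by (auto simp: eventually_sequentially)
  obtain B where B: "\<And>i. i \<ge> B \<Longrightarrow> Y u (m + int i) w = 0"
    using eventually_Y_zero[of u m w] by (auto simp: eventually_sequentially)
  obtain C where C: "\<And>i. i \<ge> C \<Longrightarrow> Y u (l + int i) v = 0"
    using eventually_Y_zero[of u l v] by (auto simp: eventually_sequentially)
  show ?thesis
    using eventually_ge_at_top[of "max A (max B C)"]
  proof eventually_elim
    case (elim I)
    then have I: "A \<le> I" "B \<le> I" "C \<le> I" by auto
    show ?case
      using J A B C I
      by (subst (asm) (1 2 3) Sum_any_eq_sum_lessThan[where N = I]) auto
  qed
qed

lemma sum_zero_gbinomial:
  fixes g :: "nat \<Rightarrow> 'v"
  assumes "I > 0"
  shows "(\<Sum>i<I. sV (r i * (0 gchoose i)) (g i)) = sV (r 0) (g 0)"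
proof -
  have "(\<Sum>i<I. sV (r i * (0 gchoose i)) (g i)) = (\<Sum>i<I. if i = 0 then sV (r i) (g i) else 0)"
  proof (rule sum.cong[OF refl])
    fix i
    show "sV (r i * (0 gchoose i)) (g i) = (if i = 0 then sV (r i) (g i) else 0)"
      by (cases i) simp_all
  qed
  then show ?thesis using assms by simp
qed

text \<open>The Jacobi identity at \<open>l = 0\<close>: on the left only the terms with
  \<open>i = 0\<close> survive.\<close>

lemma commutator:
  assumes "\<And>i. i \<ge> N \<Longrightarrow> Y u (int i) v = 0"
  shows "Y u m (Y v n w) - Y v n (Y u m w) = (\<Sum>i<N. sV (of_int m gchoose i) (Y (Y u (int i) v) (m + n - int i) w))"
proof -
  obtain I where I: "I \<ge> Suc N"
    "(\<Sum>i<I. sV ((-1) ^ i * (of_int 0 gchoose i)) (Y u (m + 0 - int i) (Y v (n + int i) w)))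
    - (\<Sum>i<I. sV ((-1) powi 0 * (-1) ^ i * (of_int 0 gchoose i)) (Y v (n + 0 - int i) (Y u (m + int i) w)))
    = (\<Sum>i<I. sV (of_int m gchoose i) (Y (Y u (0 + int i) v) (m + n - int i) w))"
    using eventually_conj[OF eventually_ge_at_top[of "Suc N"] jacobi_eventually[of 0 u m v n w]]
    by (auto simp: eventually_sequentially)
  have "Y u m (Y v n w) - Y v n (Y u m w) = (\<Sum>i<I. sV (of_int m gchoose i) (Y (Y u (int i) v) (m + n - int i) w))"
    using I by (simp add: sum_zero_gbinomial)
  also have "\<dots> = (\<Sum>i<N. sV (of_int m gchoose i) (Y (Y u (int i) v) (m + n - int i) w))"
    by (rule sum.mono_neutral_right) (use I(1) assms in auto)
  finally show ?thesis .
qed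

text \<open>The Jacobi identity at \<open>m = 0\<close>: on the right only the term with
  \<open>i = 0\<close> survives.\<close>

lemma iterate_formula:
  "\<forall>\<^sub>F I in sequentially. Y (Y u l v) n w =
    (\<Sum>i<I. sV ((-1) ^ i * (of_int l gchoose i)) (Y u (l - int i) (Y v (n + int i) w)))
    - (\<Sum>i<I. sV ((-1) powi l * (-1) ^ i * (of_int l gchoose i)) (Y v (n + l - int i) (Y u (int i) w)))"
  using eventually_conj[OF eventually_gt_at_top[of 0] jacobi_eventually[of l u 0 v n w]]
proof eventually_elim
  case (elim I)
  then show ?case using sum_zero_gbinomial[of I "\<lambda>_. 1"] by simp
qed

text \<open>Since \<open>Y \<omega> n\<close> is L(n - 1), the indices shift by one, and the
  excluded case \<open>m + n = 2\<close> is that of the central term.\<close>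

lemma virasoro_commutator:
  assumes "m + n \<noteq> 2"
  shows "Y \<omega> m (Y \<omega> n w) - Y \<omega> n (Y \<omega> m w) = sV (of_int (m - n)) (Y \<omega> (m + n - 1) w)"
proof -
  obtain c where "\<forall>m n w. Lop Y \<omega> m (Lop Y \<omega> n w) - Lop Y \<omega> n (Lop Y \<omega> m w) =
            sV (of_int (m - n)) (Lop Y \<omega> (m + n) w)
            + (if m + n = 0 then sV (of_int (m ^ 3 - m) / 12 * c) w else 0)"
    using virasoro by blast
  from this[rule_format, of "m - 1" "n - 1" w] show ?thesis
    using assms by (simp add: Lop_def algebra_simps)
qed

lemma L_minus_1: "Y (Y \<omega> 0 v) n w = sV (- of_int n) (Y v (n - 1) w)"
  using L_minus_1_derivative[of v n w] by (simp add: Lop_def)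

lemma wspace_L1:
  assumes "x \<in> wspace k"
  shows "Y \<omega> 2 x \<in> wspace (k - 1)"
  using virasoro_commutator[of 1 2 x] assms
  by (simp add: wspace_iff Y_scale_right algebra_simps)

text \<open>In the commutator with L(0) = \<open>Y \<omega> 1\<close> only \<open>i = 0\<close> and
  \<open>i = 1\<close> remain: the former is computed by the derivative property of L(-1), the
  latter by the weight of \<open>u\<close>.\<close>

lemma wspace_Y:
  assumes "u \<in> wspace a" "v \<in> wspace b"
  shows "Y u n v \<in> wspace (a + b - n - 1)"
proof -
  obtain N where N: "\<And>i. i \<ge> N \<Longrightarrow> Y \<omega> (int i) u = 0"
    using eventually_Y_zero[of \<omega> 0 u] by (auto simp: eventually_sequentially)
  have "Y \<omega> 1 (Y u n v) - Y u n (Y \<omega> 1 v) =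
      (\<Sum>i<N+2. sV (of_int 1 gchoose i) (Y (Y \<omega> (int i) u) (1 + n - int i) v))"
    by (rule commutator) (simp add: N)
  also have "\<dots> = (\<Sum>i<2. sV (of_int 1 gchoose i) (Y (Y \<omega> (int i) u) (1 + n - int i) v))"
  proof (rule sum.mono_neutral_right)
    show "\<forall>i\<in>{..<N + 2} - {..<2}. sV (of_int 1 gchoose i) (Y (Y \<omega> (int i) u) (1 + n - int i) v) = 0"
      using gbinomial_of_nat_eq_0[of 1, where 'a=complex] by auto
  qed auto
  also have "\<dots> = sV (of_int (a - n - 1)) (Y u n v)"
    using assms(1) by (simp add: numeral_2_eq_2 L_minus_1 Y_scale_left wspace_iff algebra_simps scale_left_diff_distrib[symmetric] scale_left_distrib[symmetric])
  finally show ?thesis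
    using assms(2) by (simp add: wspace_iff Y_scale_right algebra_simps scale_left_distrib scale_left_diff_distrib)
qed

text \<open>\<open>Y \<omega> 2\<close> is L(1). The commutator has three terms, with L(-1)u, L(0)u
  and L(1)u; the first two give -(n + 2) and 2a times \<open>Y u (n + 1) v\<close>.\<close>

lemma L1_commutator:
  assumes "u \<in> wspace a"
  shows "Y \<omega> 2 (Y u n v) = Y u n (Y \<omega> 2 v) + Y (Y \<omega> 2 u) n v + sV (of_int (2 * a - 2 - n)) (Y u (n + 1) v)"
proof -
  obtain N where N: "\<And>i. i \<ge> N \<Longrightarrow> Y \<omega> (int i) u = 0"
    using eventually_Y_zero[of \<omega> 0 u] by (auto simp: eventually_sequentially)
  have "Y \<omega> 2 (Y u n v) - Y u n (Y \<omega> 2 v) =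
      (\<Sum>i<N+3. sV (of_int 2 gchoose i) (Y (Y \<omega> (int i) u) (2 + n - int i) v))"
    by (rule commutator) (simp add: N)
  also have "\<dots> = (\<Sum>i<3. sV (of_int 2 gchoose i) (Y (Y \<omega> (int i) u) (2 + n - int i) v))"
  proof (rule sum.mono_neutral_right)
    show "\<forall>i\<in>{..<N + 3} - {..<3}. sV (of_int 2 gchoose i) (Y (Y \<omega> (int i) u) (2 + n - int i) v) = 0"
      using gbinomial_of_nat_eq_0[of 2, where 'a=complex] by auto
  qed auto
  also have "\<dots> = Y (Y \<omega> 2 u) n v + sV (of_int (2 * a - 2 - n)) (Y u (n + 1) v)"
    using assms by (simp add: numeral_3_eq_3 L_minus_1 Y_scale_left wspace_iff algebra_simps gbinomial_Suc  scale_left_diff_distrib scale_left_distrib scale_minus_left)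
  finally show ?thesis by (simp add: algebra_simps)
qed

section \<open>Divided powers of L(1), the coefficients of its exponential\<close>

definition L1_div :: "nat \<Rightarrow> 'v \<Rightarrow> 'v"
  where "L1_div j v = sV (1 / fact j) ((Y \<omega> 2 ^^ j) v)"

lemma L1_div_0 [simp]: "L1_div 0 v = v"
  by (simp add: L1_div_def)

lemma L1_L1_div: "Y \<omega> 2 (L1_div j v) = sV (of_nat (Suc j)) (L1_div (Suc j) v)"
proof -
  have "of_nat (Suc j) * (1 / fact (Suc j)) = (1 / fact j :: complex)"
    by (simp only: fact_Suc of_nat_mult) (simp del: of_nat_Suc)
  then show ?thesis by (simp add: L1_div_def Y_scale_right del: of_nat_Suc fact_Suc)
qed

lemma L1_div_Suc: "L1_div (Suc j) v = sV (1 / of_nat (Suc j)) (Y \<omega> 2 (L1_div j v))"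
  by (simp add: L1_L1_div del: of_nat_Suc)

lemma L1_div_add: "L1_div j (v + w) = L1_div j v + L1_div j w"
  by (induction j) (simp_all add: L1_div_Suc Y_add_right scale_right_distrib)

lemma L1_div_scale: "L1_div j (sV c v) = sV c (L1_div j v)"
  by (induction j) (simp_all add: L1_div_Suc Y_scale_right mult.commute)

lemma wspace_L1_div: "v \<in> wspace k \<Longrightarrow> L1_div j v \<in> wspace (k - int j)"
proof (induction j)
  case (Suc j)
  then have "Y \<omega> 2 (L1_div j v) \<in> wspace (k - int j - 1)" by (intro wspace_L1)
  then show ?case by (simp add: L1_div_Suc wspace_iff Y_scale_right mult.commute diff_diff_add)
qed simp

text \<open>The coefficient of \<open>t\<^sup>s\<close> in \<open>e\<^bsup>tL(1)\<^esup> u\<^sub>n v = (e\<^bsup>tL(1)\<^esup> u\<^sub>n e\<^bsup>-tL(1)\<^esup>) e\<^bsup>tL(1)\<^esup> v\<close>.\<close>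

lemma L1_power_Y:
  assumes u: "u \<in> wspace a"
  shows "L1_div s (Y u n v) = (\<Sum>(j, k, p)\<in>triples s.
    sV (of_int (2 * a - 2 - n - int j) gchoose p) (Y (L1_div j u) (n + int p) (L1_div k v)))"
proof (induction s)
  case 0
  have "triples 0 = {(0, 0, 0)}" by (auto simp: triples_def)
  then show ?case by simp
next
  case (Suc s)
  define T where "T j k p = Y (L1_div j u) (n + int p) (L1_div k v)" for j k p
  define X where "X = 2 * a - 2 - n"
  define c :: "nat \<Rightarrow> nat \<Rightarrow> complex" where "c j p = (of_int (X - int j) gchoose p)" for j p
  \<comment> \<open>The coefficient that the third term of \<open>LT\<close> acquires once
    \<open>p\<close> is shifted by one.\<close>
  define d :: "nat \<Rightarrow> nat \<Rightarrow> complex"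
    where "d j p = (if p = 0 then 0 else of_int (X - 2 * int j - int p + 1) * c j (p - 1))" for j p
  have LT: "Y \<omega> 2 (T j k p) = sV (of_nat (Suc k)) (T j (Suc k) p) + sV (of_nat (Suc j)) (T (Suc j) k p)
      + sV (of_int (X - 2 * int j - int p)) (T j k (Suc p))" for j k p
  proof -
    have "n + int p + 1 = n + int (Suc p)" "2 * (a - int j) - 2 - (n + int p) = X - 2 * int j - int p"
      by (simp_all add: X_def)
    then show ?thesis
      using L1_commutator[OF wspace_L1_div[OF u], of j "n + int p" "L1_div k v"]
      by (simp only: L1_L1_div Y_scale_left Y_scale_right T_def)
  qed
  have "sV (of_nat (Suc s)) (L1_div (Suc s) (Y u n v)) = Y \<omega> 2 (L1_div s (Y u n v))"
    by (simp add: L1_L1_div)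
  also have "\<dots> = (\<Sum>(j, k, p)\<in>triples s. sV (c j p) (Y \<omega> 2 (T j k p)))"
    by (simp add: Suc Y_sum_right split_def Y_scale_right T_def c_def X_def)
  also have "\<dots> = (\<Sum>(j, k, p)\<in>triples s. sV (of_nat (Suc k) * c j p) (T j (Suc k) p))
      + (\<Sum>(j, k, p)\<in>triples s. sV (of_nat (Suc j) * c j p) (T (Suc j) k p))
      + (\<Sum>(j, k, p)\<in>triples s. sV (of_int (X - 2 * int j - int p) * c j p) (T j k (Suc p)))"
    by (simp add: LT scale_right_distrib sum.distrib split_def mult.commute del: of_nat_Suc)
  \<comment> \<open>L(1) raises one of the three indices by one, so each sum is rewritten over
    \<open>triples (Suc s)\<close> with a coefficient that vanishes where the raised index is
    0.\<close>
  also have "(\<Sum>(j, k, p)\<in>triples s. sV (of_nat (Suc k) * c j p) (T j (Suc k) p))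
      = (\<Sum>(j, k, p)\<in>triples (Suc s). sV (of_nat k * c j p) (T j k p))"
    by (rule sum_triples_Suc_snd[symmetric]) simp
  also have "(\<Sum>(j, k, p)\<in>triples s. sV (of_nat (Suc j) * c j p) (T (Suc j) k p))
      = (\<Sum>(j, k, p)\<in>triples (Suc s). sV (of_nat j * c (j - 1) p) (T j k p))"
    by (subst sum_triples_Suc_fst) simp_all
  also have "(\<Sum>(j, k, p)\<in>triples s. sV (of_int (X - 2 * int j - int p) * c j p) (T j k (Suc p)))
      = (\<Sum>(j, k, p)\<in>triples (Suc s). sV (d j p) (T j k p))"
    by (subst sum_triples_Suc_third) (simp_all add: d_def algebra_simps)
  also have "(\<Sum>(j, k, p)\<in>triples (Suc s). sV (of_nat k * c j p) (T j k p)) +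
      (\<Sum>(j, k, p)\<in>triples (Suc s). sV (of_nat j * c (j - 1) p) (T j k p)) +
      (\<Sum>(j, k, p)\<in>triples (Suc s). sV (d j p) (T j k p))
      = (\<Sum>(j, k, p)\<in>triples (Suc s). sV (of_nat k * c j p + of_nat j * c (j - 1) p + d j p) (T j k p))"
    by (simp add: sum.distrib split_def scale_left_distrib)
  also have "\<dots> = (\<Sum>(j, k, p)\<in>triples (Suc s). sV (of_nat (Suc s) * c j p) (T j k p))"
  proof (rule sum.cong[OF refl], clarify)
    fix j k p assume "(j, k, p) \<in> triples (Suc s)"
    then have s: "Suc s = j + k + p" by (simp add: triples_def)
    \<comment> \<open>For \<open>p = Suc q\<close>, Pascal's rule expands
      \<open>c (j - 1) p\<close>, the terms in \<open>j * (z gchoose q)\<close> cancel, and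
      absorption turns \<open>(z - q) * (z gchoose q)\<close> into \<open>p * c j p\<close>.\<close>
    have "of_nat j * c (j - 1) p + d j p = of_nat (j + p) * c j p"
    proof (cases p)
      case 0
      then show ?thesis by (simp add: c_def d_def)
    next
      case (Suc q)
      define z :: complex where "z = of_int (X - int j)"
      have absorb: "(z - of_nat q) * (z gchoose q) = of_nat (Suc q) * (z gchoose Suc q)"
        using gbinomial_absorb_comp[of z q] Suc_times_gbinomial[of q "z - 1"] by (simp del: of_nat_Suc)
      have "of_nat j * c (j - 1) p = of_nat j * ((z gchoose q) + (z gchoose Suc q))"
      proof (cases j)
        case (Suc i)
        then have "of_int (X - int (j - 1)) = z + 1" by (simp add: z_def)
        then show ?thesis using gbinomial_Suc_Suc[of z q] \<open>p = Suc q\<close> by (simp only: c_def)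
      qed simp
      moreover have "d j p = (z - of_nat q - of_nat j) * (z gchoose q)"
        by (simp add: d_def c_def z_def Suc algebra_simps)
      moreover have "c j p = (z gchoose Suc q)"
        by (simp only: c_def z_def Suc)
      ultimately show ?thesis
        using absorb by (simp add: Suc algebra_simps)
    qed
    then have "of_nat k * c j p + of_nat j * c (j - 1) p + d j p = of_nat (Suc s) * c j p"
      unfolding s by (simp add: algebra_simps)
    then show "sV (of_nat k * c j p + of_nat j * c (j - 1) p + d j p) (T j k p) = sV (of_nat (Suc s) * c j p) (T j k p)"
      by (rule arg_cong)
  qed
  also have "\<dots> = sV (of_nat (Suc s)) (\<Sum>(j, k, p)\<in>triples (Suc s). sV (c j p) (T j k p))"
    by (simp add: scale_sum_right split_def del: of_nat_Suc)
  finally show ?case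
    by (simp add: T_def c_def X_def del: of_nat_Suc)
qed

end

section \<open>The opposite Jacobi identity\<close>

lemma sum_triples_box:
  fixes g :: "nat \<Rightarrow> nat \<Rightarrow> nat \<Rightarrow> 'a::comm_monoid_add"
  assumes "\<And>j k p. j \<ge> J \<or> k \<ge> K \<or> p \<ge> P \<Longrightarrow> g j k p = 0" and S: "S \<ge> J + K + P"
  shows "(\<Sum>s<S. \<Sum>(j, k, p)\<in>triples s. g j k p) = (\<Sum>j<J. \<Sum>k<K. \<Sum>p<P. g j k p)"
proof -
  have "(\<Sum>s<S. \<Sum>(j, k, p)\<in>triples s. g j k p) = (\<Sum>(j, k, p)\<in>(\<Union>s<S. triples s). g j k p)"
    by (rule sum.UNION_disjoint[symmetric]) (simp_all, auto simp: triples_def)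
  also have "\<dots> = (\<Sum>(j, k, p)\<in>{..<J} \<times> {..<K} \<times> {..<P}. g j k p)"
  proof (rule sum.mono_neutral_right)
    show "{..<J} \<times> {..<K} \<times> {..<P} \<subseteq> (\<Union>s<S. triples s)"
      using S by (auto simp: triples_def)
    show "\<forall>t\<in>(\<Union>s<S. triples s) - {..<J} \<times> {..<K} \<times> {..<P}. (case t of (j, k, p) \<Rightarrow> g j k p) = 0"
    proof
      fix t assume t: "t \<in> (\<Union>s<S. triples s) - {..<J} \<times> {..<K} \<times> {..<P}"
      obtain j k p where jkp: "t = (j, k, p)" by (cases t)
      then have "j \<ge> J \<or> k \<ge> K \<or> p \<ge> P" using t by auto
      then show "(case t of (j, k, p) \<Rightarrow> g j k p) = 0" by (simp add: jkp assms(1))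
    qed
  qed simp
  also have "\<dots> = (\<Sum>j<J. \<Sum>k<K. \<Sum>p<P. g j k p)"
    by (simp add: sum.cartesian_product)
  finally show ?thesis .
qed

context vector_space
begin

text \<open>The terms are collected by \<open>q = i + p\<close>; the square and the triangle
  \<open>i + p < I\<close> differ only in terms where \<open>G\<close> vanishes.\<close>

lemma sum_convolution:
  fixes G :: "nat \<Rightarrow> 'b"
    and b :: "nat \<Rightarrow> nat \<Rightarrow> 'a"
  assumes "\<And>q. q \<ge> I \<Longrightarrow> G q = 0"
  shows "(\<Sum>i<I. \<Sum>p<I. scale (b i p) (G (i + p))) = (\<Sum>q<I. scale (\<Sum>i\<le>q. b i (q - i)) (G q))"
proof -
  have "(\<Sum>i<I. \<Sum>p<I. scale (b i p) (G (i + p))) = (\<Sum>(i, p)\<in>{..<I} \<times> {..<I}. scale (b i p) (G (i + p)))"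
    by (simp add: sum.cartesian_product)
  also have "\<dots> = (\<Sum>(i, p)\<in>{(i, p). i + p < I}. scale (b i p) (G (i + p)))"
  proof (rule sum.mono_neutral_right)
    show "\<forall>t\<in>{..<I} \<times> {..<I} - {(i, p). i + p < I}. (case t of (i, p) \<Rightarrow> scale (b i p) (G (i + p))) = 0"
      using assms by (simp add: split_def)
  qed auto
  also have "\<dots> = (\<Sum>q<I. \<Sum>i\<le>q. scale (b i (q - i)) (G q))"
    by (simp add: sum.triangle_reindex)
  finally show ?thesis by (simp add: scale_sum_left)
qed

end

section \<open>The weight grading and its projections\<close>

context vertex_operator_algebra
begin

text \<open>An arbitrary bound below which all weight spaces vanish, not necessarily the best
  one.\<close>

definition weight_bound :: int
  where "weight_bound = (SOME N. \<forall>n<N. wspace n = {0})"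

lemma wspace_below: "n < weight_bound \<Longrightarrow> wspace n = {0}"
  using someI_ex[of "\<lambda>N. \<forall>n<N. wspace n = {0}"] lower_truncation
  unfolding weight_bound_def wspace_def by blast

lemma subspace_wspace: "subspace (wspace k)"
  using grading by (simp add: direct_sum_def wspace_def)

lemma zero_wspace [simp]: "0 \<in> wspace k"
  using subspace_wspace subspace_0 by blast

text \<open>L(1) lowers the weight by one, so from this \<open>j\<close> on the weight is below
  \<open>weight_bound\<close>.\<close>

lemma L1_div_eq_0:
  assumes "x \<in> wspace k" "j \<ge> nat (k - weight_bound + 1)"
  shows "L1_div j x = 0"
proof -
  have "k - int j < weight_bound" using assms(2) by linarith
  then show ?thesis using wspace_L1_div[OF assms(1), of j] wspace_below by blast
qed

text \<open>Finite support is demanded explicitly because \<open>Sum_any\<close> returns 0 on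
  families with infinite support.\<close>

definition decomposes :: "'v \<Rightarrow> (int \<Rightarrow> 'v) \<Rightarrow> bool"
  where "decomposes v g \<longleftrightarrow> finite {k. g k \<noteq> 0} \<and> (\<forall>k. g k \<in> wspace k) \<and> Sum_any g = v"

lemma decomposes_add:
  assumes "decomposes v g" "decomposes w h"
  shows "decomposes (v + w) (\<lambda>k. g k + h k)"
proof -
  have "finite {k. g k + h k \<noteq> 0}"
    by (rule finite_subset[of _ "{k. g k \<noteq> 0} \<union> {k. h k \<noteq> 0}"]) (use assms in \<open>auto simp: decomposes_def\<close>)
  then show ?thesis
    using assms subspace_add[OF subspace_wspace] by (simp add: decomposes_def Sum_any.distrib)
qed

lemma decomposes_scale:
  assumes "decomposes v g"
  shows "decomposes (sV c v) (\<lambda>k. sV c (g k))"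
proof -
  have g: "finite {k. g k \<noteq> 0}" using assms by (simp add: decomposes_def)
  have sub: "{k. sV c (g k) \<noteq> 0} \<subseteq> {k. g k \<noteq> 0}" by auto
  have "Sum_any (\<lambda>k. sV c (g k)) = sV c (Sum_any g)"
    using Sum_any.expand_superset[OF g sub] by (simp add: Sum_any.expand_set[of g] scale_sum_right)
  moreover have "finite {k. sV c (g k) \<noteq> 0}" using finite_subset[OF sub g] .
  ultimately show ?thesis
    using assms subspace_scale[OF subspace_wspace] by (simp add: decomposes_def)
qed

lemma decomposes_homogeneous:
  assumes "x \<in> wspace k"
  shows "decomposes x (\<lambda>i. if i = k then x else 0)"
proof -
  have "Sum_any (\<lambda>i. if i = k then x else 0) = (\<Sum>i\<in>{k}. if i = k then x else 0)"
    by (rule Sum_any.expand_superset) auto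
  then show ?thesis using assms by (simp add: decomposes_def)
qed

lemma decomposes_unique:
  assumes "decomposes v g" "decomposes v h"
  shows "g = h"
proof
  fix k
  have d: "decomposes 0 (\<lambda>k. g k + sV (-1) (h k))"
    using decomposes_add[OF assms(1) decomposes_scale[OF assms(2), of "-1"]] by simp
  define J where "J = insert k {k. g k + sV (-1) (h k) \<noteq> 0}"
  have J: "finite J" using d by (simp add: J_def decomposes_def)
  have "(\<Sum>k\<in>J. g k + sV (-1) (h k)) = Sum_any (\<lambda>k. g k + sV (-1) (h k))"
    by (rule Sum_any.expand_superset[symmetric, OF J]) (auto simp: J_def)
  also have "\<dots> = 0" using d by (simp add: decomposes_def)
  finally have "(\<Sum>k\<in>J. g k + sV (-1) (h k)) = 0" .
  moreover have "\<forall>k\<in>J. g k + sV (-1) (h k) \<in> wspace k"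
    using d unfolding decomposes_def by blast
  moreover have "\<forall>J f. finite J \<and> J \<subseteq> UNIV \<and> (\<forall>i\<in>J. f i \<in> wspace i) \<and> (\<Sum>i\<in>J. f i) = 0 \<longrightarrow> (\<forall>i\<in>J. f i = 0)"
    using grading unfolding direct_sum_def wspace_def by blast
  ultimately have "\<forall>k\<in>J. g k + sV (-1) (h k) = 0"
    using J by (metis (no_types, lifting) subset_UNIV)
  then show "g k = h k" by (simp add: J_def)
qed

lemma decomposes_exists: "\<exists>g. decomposes v g"
proof -
  have "v \<in> span (\<Union>k. wspace k)"
    using grading by (simp add: direct_sum_def wspace_def)
  then show ?thesis
  proof (induction rule: span_induct_alt)
    case base
    show ?case using decomposes_homogeneous[of 0 0] by auto
  next
    case (step c x y)
    then show ?case by (blast intro: decomposes_add decomposes_scale decomposes_homogeneous)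
  qed
qed

definition proj :: "int \<Rightarrow> 'v \<Rightarrow> 'v"
  where "proj k v = (SOME g. decomposes v g) k"

lemma decomposes_proj: "decomposes v (\<lambda>k. proj k v)"
  using someI_ex[OF decomposes_exists, of v] by (simp add: proj_def)

lemma proj_eq: "decomposes v g \<Longrightarrow> proj k v = g k"
  using decomposes_unique[OF decomposes_proj] by metis

lemma proj_add: "proj k (v + w) = proj k v + proj k w"
  by (rule proj_eq[OF decomposes_add[OF decomposes_proj decomposes_proj]])

lemma proj_scale: "proj k (sV c v) = sV c (proj k v)"
  by (rule proj_eq[OF decomposes_scale[OF decomposes_proj]])

lemma proj_homogeneous: "x \<in> wspace k \<Longrightarrow> proj i x = (if i = k then x else 0)"
  using proj_eq[OF decomposes_homogeneous] by auto

lemma proj_wspace: "proj k v \<in> wspace k"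
  and finite_proj: "finite {k. proj k v \<noteq> 0}"
  and Sum_any_proj: "Sum_any (\<lambda>k. proj k v) = v"
  using decomposes_proj[of v] by (simp_all add: decomposes_def)

lemma sum_proj: "(\<Sum>k | proj k v \<noteq> 0. proj k v) = v"
  using Sum_any_proj[of v] by (simp add: Sum_any.expand_set)

lemma homogeneous_induct [case_names homogeneous add]:
  assumes "\<And>k x. x \<in> wspace k \<Longrightarrow> P x" "\<And>x y. P x \<Longrightarrow> P y \<Longrightarrow> P (x + y)"
  shows "P v"
proof -
  have "P (\<Sum>k\<in>A. proj k v)" if "finite A" for A
    using that by (induction A) (simp_all add: assms(2) assms(1)[OF proj_wspace] assms(1)[OF zero_wspace])
  from this[OF finite_proj[of v]] show ?thesis by (simp add: sum_proj)
qed

text \<open>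
  The modes of the opposite vertex operator \<open>Y(e\<^bsup>xL(1)\<^esup>(-x\<^sup>-\<^sup>2)\<^bsup>L(0)\<^esup>v, x\<^sup>-\<^sup>1)\<close>, whose transpose is the
  contragredient action. For \<open>v\<close> of weight \<open>k\<close> the terms with \<open>k - j\<close> below \<open>weight_bound\<close> vanish.
\<close>

definition opp_hom :: "int \<Rightarrow> int \<Rightarrow> 'v \<Rightarrow> 'v \<Rightarrow> 'v"
  where "opp_hom k n x w = sV ((-1) powi k) (\<Sum>j<nat (k - weight_bound + 1). Y (L1_div j x) (2 * k - 2 - n - int j) w)"

definition opp :: "'v \<Rightarrow> int \<Rightarrow> 'v \<Rightarrow> 'v"
  where "opp v n w = Sum_any (\<lambda>k. opp_hom k n (proj k v) w)"

lemma opp_hom_add: "opp_hom k n (x + y) w = opp_hom k n x w + opp_hom k n y w"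
  by (simp add: opp_hom_def L1_div_add Y_add_left sum.distrib scale_right_distrib)

lemma opp_hom_scale: "opp_hom k n (sV c x) w = sV c (opp_hom k n x w)"
  by (simp add: opp_hom_def L1_div_scale Y_scale_left scale_sum_right[symmetric] mult.commute)

lemma opp_hom_zero [simp]: "opp_hom k n 0 w = 0"
  using opp_hom_scale[of k n 0 0 w] by simp

lemma opp_hom_add_right: "opp_hom k n x (v + w) = opp_hom k n x v + opp_hom k n x w"
  by (simp add: opp_hom_def Y_add_right sum.distrib scale_right_distrib)

lemma opp_hom_scale_right: "opp_hom k n x (sV c w) = sV c (opp_hom k n x w)"
  by (simp add: opp_hom_def Y_scale_right scale_sum_right[symmetric] mult.commute)

lemma opp_eq_sum:
  assumes "finite A" "{k. proj k v \<noteq> 0} \<subseteq> A"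
  shows "opp v n w = (\<Sum>k\<in>A. opp_hom k n (proj k v) w)"
  unfolding opp_def by (rule Sum_any.expand_superset[OF assms(1)]) (use assms(2) in auto)

lemma opp_add: "opp (u + v) n w = opp u n w + opp v n w"
proof -
  define A where "A = {k. proj k u \<noteq> 0} \<union> {k. proj k v \<noteq> 0}"
  have "finite A" by (simp add: A_def finite_proj)
  moreover have "{k. proj k u \<noteq> 0} \<subseteq> A" "{k. proj k v \<noteq> 0} \<subseteq> A" "{k. proj k (u + v) \<noteq> 0} \<subseteq> A"
    by (auto simp: A_def proj_add)
  ultimately show ?thesis
    by (simp add: opp_eq_sum[of A] proj_add opp_hom_add sum.distrib)
qed

lemma opp_scale: "opp (sV c v) n w = sV c (opp v n w)"
proof -
  have "{k. proj k (sV c v) \<noteq> 0} \<subseteq> {k. proj k v \<noteq> 0}" by (auto simp: proj_scale)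
  then show ?thesis
    using opp_eq_sum[OF finite_proj, of "sV c v" v] opp_eq_sum[OF finite_proj, of v v]
    by (simp add: proj_scale opp_hom_scale scale_sum_right)
qed

lemma opp_add_right: "opp v n (w + w') = opp v n w + opp v n w'"
  by (simp add: opp_eq_sum[OF finite_proj order_refl] opp_hom_add_right sum.distrib)

lemma opp_scale_right: "opp v n (sV c w) = sV c (opp v n w)"
  by (simp add: opp_eq_sum[OF finite_proj order_refl] opp_hom_scale_right scale_sum_right)

lemma opp_zero [simp]: "opp 0 n w = 0"
  using opp_scale[of 0 0 n w] by simp

text \<open>The terms beyond the cutoff vanish, so the range may be enlarged to any convenient
  \<open>J\<close>.\<close>

lemma opp_homogeneous:
  assumes "x \<in> wspace k" "J \<ge> nat (k - weight_bound + 1)"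
  shows "opp x n w = sV ((-1) powi k) (\<Sum>j<J. Y (L1_div j x) (2 * k - 2 - n - int j) w)"
proof -
  have "opp x n w = (\<Sum>i\<in>{k}. opp_hom i n (proj i x) w)"
    by (rule opp_eq_sum) (use proj_homogeneous[OF assms(1)] in auto)
  also have "\<dots> = opp_hom k n x w"
    by (simp add: proj_homogeneous[OF assms(1)])
  also have "(\<Sum>j<nat (k - weight_bound + 1). Y (L1_div j x) (2 * k - 2 - n - int j) w) = (\<Sum>j<J. Y (L1_div j x) (2 * k - 2 - n - int j) w)"
    by (rule sum.mono_neutral_left) (use assms L1_div_eq_0 in auto)
  then have "opp_hom k n x w = sV ((-1) powi k) (\<Sum>j<J. Y (L1_div j x) (2 * k - 2 - n - int j) w)"
    by (simp add: opp_hom_def)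
  finally show ?thesis .
qed

text \<open>The products are in the reverse order of those in \<^const>\<open>jacobi_identity\<close>, since transposition reverses
  them.\<close>

definition opp_jacobi :: "'v \<Rightarrow> 'v \<Rightarrow> bool"
  where "opp_jacobi u v \<longleftrightarrow> (\<forall>l m n w. \<forall>\<^sub>F I in sequentially.
    (\<Sum>i<I. sV ((-1) ^ i * (of_int l gchoose i)) (opp v (n + int i) (opp u (m + l - int i) w)))
    - (\<Sum>i<I. sV ((-1) powi l * (-1) ^ i * (of_int l gchoose i)) (opp u (m + int i) (opp v (n + l - int i) w)))
    = (\<Sum>i<I. sV (of_int m gchoose i) (opp (Y u (l + int i) v) (m + n - int i) w)))"

text \<open>
  Replacing \<open>x\<^sub>1, x\<^sub>2\<close> by their inverses turns \<open>x\<^sub>1\<^sup>m x\<^sub>2\<^sup>n (x\<^sub>1 - x\<^sub>2)\<^sup>l\<close> into a monomial of the same form with the same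
  \<open>l\<close>. So the left-hand side is a signed sum over \<open>j, k\<close> of left-hand sides of the Jacobi identity for
  \<open>L(1)\<^sup>j u / j!\<close> and \<open>L(1)\<^sup>k v / k!\<close>; the right-hand sides agree by the conjugation formula
  \<open>L1_power_Y\<close> and Vandermonde's identity.
\<close>

lemma opp_jacobi_homogeneous:
  assumes u: "u \<in> wspace a" and v: "v \<in> wspace b"
  shows "opp_jacobi u v"
  unfolding opp_jacobi_def
proof (intro allI)
  fix l m n :: int and w
  define J K where "J = nat (a - weight_bound + 1)" and "K = nat (b - weight_bound + 1)"
  \<comment> \<open>With these shifts the index \<open>m + l - i\<close> of \<open>opp u\<close>
    becomes the mode \<open>M j + i\<close>, and the index \<open>n + i\<close> of
    \<open>opp v\<close> becomes \<open>N k + l - i\<close>. Passing to opposite modes thus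
    interchanges the two products of the Jacobi identity.\<close>
  define M N where "M j = 2 * a - 2 - m - l - int j" and "N k = 2 * b - 2 - n - l - int k" for j k :: nat
  define R where "R = 2 * a + 2 * b - 2 * l - 4 - m - n"
  define G where "G j k q = Y (Y (L1_div j u) (l + int q) (L1_div k v)) (R - int q - int j - int k) w" for j k q
  define \<sigma> :: complex where "\<sigma> = (-1) powi a * (-1) powi b * (-1) powi l"
  define c :: "nat \<Rightarrow> complex" where "c i = (-1) ^ i * (of_int l gchoose i)" for i
  define P where "P j k I = (\<Sum>i<I. sV (c i) (Y (L1_div j u) (M j + l - int i) (Y (L1_div k v) (N k + int i) w)))" for j k I
  define Q where "Q j k I = (\<Sum>i<I. sV ((-1) powi l * c i) (Y (L1_div k v) (N k + l - int i) (Y (L1_div j u) (M j + int i) w)))" for j k I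
  have sq: "(-1) powi l * (-1) powi l = (1::complex)"
    by (simp add: power_int_mult_distrib[symmetric])
  have "\<forall>\<^sub>F I in sequentially. \<forall>j\<in>{..<J}. \<forall>k\<in>{..<K}. P j k I - Q j k I = (\<Sum>i<I. sV (of_int (M j) gchoose i) (G j k i))"
    unfolding P_def Q_def G_def
  proof (intro eventually_ball_finite ballI finite_lessThan)
    fix j k
    have "M j + N k - int i = R - int i - int j - int k" for i
      by (simp add: M_def N_def R_def)
    then show "\<forall>\<^sub>F I in sequentially.
        (\<Sum>i<I. sV (c i) (Y (L1_div j u) (M j + l - int i) (Y (L1_div k v) (N k + int i) w)))
        - (\<Sum>i<I. sV ((-1) powi l * c i) (Y (L1_div k v) (N k + l - int i) (Y (L1_div j u) (M j + int i) w)))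
        = (\<Sum>i<I. sV (of_int (M j) gchoose i) (Y (Y (L1_div j u) (l + int i) (L1_div k v)) (R - int i - int j - int k) w))"
      using jacobi_eventually[of l "L1_div j u" "M j" "L1_div k v" "N k" w] by (simp only: c_def mult.assoc)
  qed
  \<comment> \<open>A cutoff beyond which all iterates vanish, uniformly in \<open>j\<close> and
    \<open>k\<close>; it makes the sums over \<open>p\<close> and \<open>q\<close> below
    finite.\<close>
  moreover have "\<forall>\<^sub>F I in sequentially. \<forall>q\<ge>I. \<forall>j\<in>{..<J}. \<forall>k\<in>{..<K}. Y (L1_div j u) (l + int q) (L1_div k v) = 0"
    by (intro eventually_all_ge_at_top eventually_ball_finite ballI finite_lessThan eventually_Y_zero)
  ultimately show "\<forall>\<^sub>F I in sequentially.
      (\<Sum>i<I. sV ((-1) ^ i * (of_int l gchoose i)) (opp v (n + int i) (opp u (m + l - int i) w)))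
      - (\<Sum>i<I. sV ((-1) powi l * (-1) ^ i * (of_int l gchoose i)) (opp u (m + int i) (opp v (n + l - int i) w)))
      = (\<Sum>i<I. sV (of_int m gchoose i) (opp (Y u (l + int i) v) (m + n - int i) w))"
  proof eventually_elim
    case (elim I)
    have opp_u: "opp u r x = sV ((-1) powi a) (\<Sum>j<J. Y (L1_div j u) (2 * a - 2 - r - int j) x)" for r x
      by (rule opp_homogeneous[OF u]) (simp add: J_def)
    have opp_v: "opp v r x = sV ((-1) powi b) (\<Sum>k<K. Y (L1_div k v) (2 * b - 2 - r - int k) x)" for r x
      by (rule opp_homogeneous[OF v]) (simp add: K_def)
    \<comment> \<open>The first opposite product gives the second Jacobi sum \<open>Q\<close>, while
      \<open>lhs2\<close> gives \<open>P\<close>; this interchange accounts for the sign of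
      \<open>- \<sigma>\<close> in \<open>rhs\<close>.\<close>
    have lhs1: "(\<Sum>i<I. sV (c i) (opp v (n + int i) (opp u (m + l - int i) w))) = sV \<sigma> (\<Sum>j<J. \<Sum>k<K. Q j k I)"
    proof -
      have "sV (c i) (opp v (n + int i) (opp u (m + l - int i) w)) =
          (\<Sum>j<J. \<Sum>k<K. sV \<sigma> (sV ((-1) powi l * c i) (Y (L1_div k v) (N k + l - int i) (Y (L1_div j u) (M j + int i) w))))" for i
      proof -
        have "\<sigma> * ((-1) powi l * c i) = c i * ((-1) powi b * (-1) powi a)"
          using sq by (simp add: \<sigma>_def algebra_simps)
        moreover have "2 * a - 2 - (m + l - int i) - int j = M j + int i" "2 * b - 2 - (n + int i) - int k = N k + l - int i" for j k
          by (simp_all add: M_def N_def)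
        ultimately show ?thesis
          by (simp only: opp_u opp_v Y_scale_right Y_sum_right scale_sum_right scale_scale sum.swap[of _ "{..<K}"])
      qed
      then show ?thesis
        by (simp add: Q_def scale_sum_right sum.swap[of _ _ "{..<I}"])
    qed
    have lhs2: "(\<Sum>i<I. sV ((-1) powi l * c i) (opp u (m + int i) (opp v (n + l - int i) w))) = sV \<sigma> (\<Sum>j<J. \<Sum>k<K. P j k I)"
    proof -
      have "sV ((-1) powi l * c i) (opp u (m + int i) (opp v (n + l - int i) w)) =
          (\<Sum>j<J. \<Sum>k<K. sV \<sigma> (sV (c i) (Y (L1_div j u) (M j + l - int i) (Y (L1_div k v) (N k + int i) w))))" for i
      proof -
        have "\<sigma> * c i = (-1) powi l * c i * ((-1) powi a * (-1) powi b)"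
          by (simp add: \<sigma>_def algebra_simps)
        moreover have "2 * a - 2 - (m + int i) - int j = M j + l - int i" "2 * b - 2 - (n + l - int i) - int k = N k + int i" for j k
          by (simp_all add: M_def N_def)
        ultimately show ?thesis
          by (simp only: opp_u opp_v Y_scale_right Y_sum_right scale_sum_right scale_scale)
      qed
      then show ?thesis
        by (simp add: P_def scale_sum_right sum.swap[of _ _ "{..<I}"])
    qed
    have rhs: "(\<Sum>i<I. sV (of_int m gchoose i) (opp (Y u (l + int i) v) (m + n - int i) w))
        = sV (- \<sigma>) (\<Sum>j<J. \<Sum>k<K. \<Sum>i<I. sV (of_int (M j) gchoose i) (G j k i))"
    proof -
      \<comment> \<open>Large enough both for the L(1) cutoff of every
        \<open>Y u (l + int i) v\<close> and for the layers below \<open>S\<close> to contain the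
        box given by \<open>J\<close>, \<open>K\<close> and \<open>I\<close>.\<close>
      define S where "S = J + K + I + nat (a + b - l - weight_bound)"
      define Z :: "nat \<Rightarrow> complex" where "Z j = of_int (2 * a - 2 - l - int j)" for j
      have opp_Y: "sV (of_int m gchoose i) (opp (Y u (l + int i) v) (m + n - int i) w) =
          (\<Sum>j<J. \<Sum>k<K. \<Sum>p<I. sV (- \<sigma>) (sV ((-1) ^ i * (of_int m gchoose i) * ((Z j - of_nat i) gchoose p)) (G j k (i + p))))"
        if i: "i < I" for i
      proof -
        define \<kappa> where "\<kappa> = a + b - (l + int i) - 1"
        have x: "Y u (l + int i) v \<in> wspace \<kappa>"
          unfolding \<kappa>_def by (rule wspace_Y[OF u v])
        \<comment> \<open>The summand -1 in the weight \<open>\<kappa>\<close> produces the minus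
          sign.\<close>
        have sign: "(-1) powi \<kappa> = - \<sigma> * (-1) ^ i"
        proof -
          have "inverse ((-1) ^ i * (-1) powi l) = ((-1) ^ i * (-1) powi l :: complex)"
            by (rule inverse_unique) (use sq in \<open>simp add: algebra_simps mult.assoc[symmetric]\<close>)
          moreover have "(-1) powi \<kappa> = - ((-1) powi a * (-1) powi b) * inverse ((-1) ^ i * (-1) powi l :: complex)"
            by (simp add: \<kappa>_def power_int_add power_int_diff field_simps)
          ultimately show ?thesis by (simp only: \<sigma>_def) simp
        qed
        have "opp (Y u (l + int i) v) (m + n - int i) w
            = sV ((-1) powi \<kappa>) (\<Sum>s<S. Y (L1_div s (Y u (l + int i) v)) (2 * \<kappa> - 2 - (m + n - int i) - int s) w)"
          by (rule opp_homogeneous[OF x]) (simp add: S_def \<kappa>_def)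
        also have "(\<Sum>s<S. Y (L1_div s (Y u (l + int i) v)) (2 * \<kappa> - 2 - (m + n - int i) - int s) w)
            = (\<Sum>s<S. \<Sum>(j, k, p)\<in>triples s. sV ((Z j - of_nat i) gchoose p) (G j k (i + p)))"
        proof (rule sum.cong[OF refl])
          fix s
          show "Y (L1_div s (Y u (l + int i) v)) (2 * \<kappa> - 2 - (m + n - int i) - int s) w
              = (\<Sum>(j, k, p)\<in>triples s. sV ((Z j - of_nat i) gchoose p) (G j k (i + p)))"
            unfolding L1_power_Y[OF u] Y_sum_left
          proof (rule sum.cong[OF refl], clarify)
            fix j k p assume "(j, k, p) \<in> triples s"
            then have "s = j + k + p" by (simp add: triples_def)
            then have "2 * \<kappa> - 2 - (m + n - int i) - int s = R - int (i + p) - int j - int k"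
              "l + int i + int p = l + int (i + p)" "of_int (2 * a - 2 - (l + int i) - int j) = Z j - of_nat i"
              by (simp_all add: \<kappa>_def R_def Z_def)
            then show "Y (sV (of_int (2 * a - 2 - (l + int i) - int j) gchoose p) (Y (L1_div j u) (l + int i + int p) (L1_div k v)))
                (2 * \<kappa> - 2 - (m + n - int i) - int s) w = sV ((Z j - of_nat i) gchoose p) (G j k (i + p))"
              by (simp only: G_def Y_scale_left)
          qed
        qed
        \<comment> \<open>Beyond \<open>J\<close> or \<open>K\<close> the divided powers of L(1)
          vanish; inside, the mode \<open>l + i + p\<close> vanishes for \<open>p \<ge> I\<close> by
          truncation.\<close>
        also have "\<dots> = (\<Sum>j<J. \<Sum>k<K. \<Sum>p<I. sV ((Z j - of_nat i) gchoose p) (G j k (i + p)))"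
        proof (rule sum_triples_box)
          fix j k p
          assume *: "j \<ge> J \<or> k \<ge> K \<or> p \<ge> I"
          have "Y (L1_div j u) (l + int (i + p)) (L1_div k v) = 0"
          proof (cases "j \<ge> J \<or> k \<ge> K")
            case True
            then show ?thesis using L1_div_eq_0[OF u] L1_div_eq_0[OF v] by (auto simp: J_def K_def)
          next
            case False
            with * have "i + p \<ge> I" "j \<in> {..<J}" "k \<in> {..<K}" by auto
            then show ?thesis using elim(2) by blast
          qed
          then show "sV ((Z j - of_nat i) gchoose p) (G j k (i + p)) = 0" by (simp add: G_def)
        qed (simp add: S_def)
        finally show ?thesis
          by (simp add: sign scale_sum_right mult.assoc mult.commute mult.left_commute)
      qed
      have "(\<Sum>i<I. sV (of_int m gchoose i) (opp (Y u (l + int i) v) (m + n - int i) w))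
        = (\<Sum>i<I. \<Sum>j<J. \<Sum>k<K. \<Sum>p<I. sV (- \<sigma>) (sV ((-1) ^ i * (of_int m gchoose i) * ((Z j - of_nat i) gchoose p)) (G j k (i + p))))"
        by (rule sum.cong) (simp_all only: opp_Y lessThan_iff)
      also have "\<dots> = sV (- \<sigma>) (\<Sum>j<J. \<Sum>k<K. \<Sum>i<I. \<Sum>p<I. sV ((-1) ^ i * (of_int m gchoose i) * ((Z j - of_nat i) gchoose p)) (G j k (i + p)))"
        unfolding scale_sum_right by (rule trans[OF sum.swap], rule sum.cong[OF refl], rule sum.swap)
      also have "(\<Sum>j<J. \<Sum>k<K. \<Sum>i<I. \<Sum>p<I. sV ((-1) ^ i * (of_int m gchoose i) * ((Z j - of_nat i) gchoose p)) (G j k (i + p)))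
        = (\<Sum>j<J. \<Sum>k<K. \<Sum>i<I. sV (of_int (M j) gchoose i) (G j k i))"
      proof (rule sum.cong[OF refl], rule sum.cong[OF refl])
        fix j k assume jk: "j \<in> {..<J}" "k \<in> {..<K}"
        \<comment> \<open>Collecting by \<open>q = i + p\<close> leaves an alternating Vandermonde
          sum, whose upper argument is \<open>Z j - m = M j\<close>.\<close>
        have "(\<Sum>i<I. \<Sum>p<I. sV ((-1) ^ i * (of_int m gchoose i) * ((Z j - of_nat i) gchoose p)) (G j k (i + p)))
          = (\<Sum>q<I. sV (\<Sum>i\<le>q. (-1) ^ i * (of_int m gchoose i) * ((Z j - of_nat i) gchoose (q - i))) (G j k q))"
          by (rule sum_convolution) (use elim(2) jk in \<open>simp add: G_def\<close>)
        moreover have "Z j - of_int m = of_int (M j)" by (simp add: Z_def M_def)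
        ultimately show "(\<Sum>i<I. \<Sum>p<I. sV ((-1) ^ i * (of_int m gchoose i) * ((Z j - of_nat i) gchoose p)) (G j k (i + p)))
          = (\<Sum>i<I. sV (of_int (M j) gchoose i) (G j k i))"
          by (simp only: gbinomial_alternating_Vandermonde)
      qed
      finally show ?thesis .
    qed
    have "sV \<sigma> (\<Sum>j<J. \<Sum>k<K. Q j k I) - sV \<sigma> (\<Sum>j<J. \<Sum>k<K. P j k I)
        = sV (- \<sigma>) (\<Sum>j<J. \<Sum>k<K. P j k I - Q j k I)"
      by (simp add: sum_subtractf scale_right_diff_distrib)
    also have "(\<Sum>j<J. \<Sum>k<K. P j k I - Q j k I) = (\<Sum>j<J. \<Sum>k<K. \<Sum>i<I. sV (of_int (M j) gchoose i) (G j k i))"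
      by (rule sum.cong[OF refl], rule sum.cong[OF refl]) (use elim(1) in blast)
    finally show ?case
      using lhs1 lhs2 rhs by (simp only: c_def mult.assoc)
  qed
qed

text \<open>Both sides are additive in \<open>u\<close> and in \<open>v\<close>, which reduces the
  identity to homogeneous vectors.\<close>

lemma opp_jacobi: "opp_jacobi u v"
proof (induction u rule: homogeneous_induct)
  case u: (homogeneous a u)
  show ?case
  proof (induction v rule: homogeneous_induct)
    case (homogeneous b v)
    then show ?case using u by (rule opp_jacobi_homogeneous[rotated])
  next
    case (add v v')
    show ?case
      unfolding opp_jacobi_def
    proof (intro allI)
      fix l m n w
      from add[unfolded opp_jacobi_def, rule_format, of l n m w]
      show "\<forall>\<^sub>F I in sequentially.
        (\<Sum>i<I. sV ((-1) ^ i * (of_int l gchoose i)) (opp (v + v') (n + int i) (opp u (m + l - int i) w)))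
        - (\<Sum>i<I. sV ((-1) powi l * (-1) ^ i * (of_int l gchoose i)) (opp u (m + int i) (opp (v + v') (n + l - int i) w)))
        = (\<Sum>i<I. sV (of_int m gchoose i) (opp (Y u (l + int i) (v + v')) (m + n - int i) w))"
        by eventually_elim
          (simp add: opp_add opp_add_right Y_add_right sum.distrib scale_right_distrib add_diff_add)
    qed
  qed
next
  case (add u u')
  show ?case
    unfolding opp_jacobi_def
  proof (intro allI)
    fix l m n w
    from add[unfolded opp_jacobi_def, rule_format, of l n m w]
    show "\<forall>\<^sub>F I in sequentially.
      (\<Sum>i<I. sV ((-1) ^ i * (of_int l gchoose i)) (opp v (n + int i) (opp (u + u') (m + l - int i) w)))
      - (\<Sum>i<I. sV ((-1) powi l * (-1) ^ i * (of_int l gchoose i)) (opp (u + u') (m + int i) (opp v (n + l - int i) w)))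
      = (\<Sum>i<I. sV (of_int m gchoose i) (opp (Y (u + u') (l + int i) v) (m + n - int i) w))"
      by eventually_elim
        (simp add: opp_add opp_add_right Y_add_left sum.distrib scale_right_distrib add_diff_add)
  qed
qed

lemmas opp_jacobi_eventually = opp_jacobi[unfolded opp_jacobi_def, rule_format]

end

section \<open>The contragredient weak module\<close>

lemma vector_space_fun_scale: "vector_space fun_scale"
  by unfold_locales (auto simp: fun_scale_def fun_eq_iff algebra_simps)

lemma sum_fun_apply: "(\<Sum>i\<in>A. F i) w = (\<Sum>i\<in>A. F i w)"
  by (induction A rule: infinite_finite_induct) simp_all

section \<open>Linear functionals and separation from subspaces\<close>

context vertex_operator_algebra
begin

definition linear_functional :: "('v \<Rightarrow> complex) \<Rightarrow> bool"
  where "linear_functional f \<longleftrightarrow> (\<forall>v w. f (v + w) = f v + f w) \<and> (\<forall>c v. f (sV c v) = c * f v)"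

lemma linear_functional_add: "linear_functional f \<Longrightarrow> f (v + w) = f v + f w"
  and linear_functional_scale: "linear_functional f \<Longrightarrow> f (sV c v) = c * f v"
  by (simp_all add: linear_functional_def)

lemma linear_functional_zero: "linear_functional f \<Longrightarrow> f 0 = 0"
  using linear_functional_scale[of f 0 0] by simp

lemma linear_functional_sum: "linear_functional f \<Longrightarrow> f (\<Sum>i\<in>A. g i) = (\<Sum>i\<in>A. f (g i))"
  by (induction A rule: infinite_finite_induct)
    (simp_all add: linear_functional_zero linear_functional_add)

lemma linear_functional_diff: "linear_functional f \<Longrightarrow> f (v - w) = f v - f w"
  using linear_functional_add[of f "v - w" w] by simp

lemma linear_functional_zero_on_span:
  assumes "linear_functional f" "\<And>x. x \<in> S \<Longrightarrow> f x = 0" "x \<in> span S"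
  shows "f x = 0"
  using assms(3)
  by (induction rule: span_induct_alt)
    (simp_all add: assms linear_functional_zero linear_functional_add linear_functional_scale)

text \<open>A basis of \<open>C\<close> stays independent when \<open>x\<close> is adjoined; the
  functional with value 1 at \<open>x\<close> and 0 on that basis extends to the whole
  space.\<close>

lemma separating_functional:
  assumes C: "subspace C" and x: "x \<notin> C"
  obtains g where "linear_functional g" "\<And>c. c \<in> C \<Longrightarrow> g c = 0" "g x = 1"
proof -
  interpret p: vector_space_pair sV "(*) :: complex \<Rightarrow> complex \<Rightarrow> complex"
    by unfold_locales (simp_all add: algebra_simps)
  obtain B where B: "B \<subseteq> C" "independent B" "C \<subseteq> span B"
    by (rule maximal_independent_subset)
  have "x \<notin> span B" using span_minimal[OF B(1) C] x by blast
  with B have "independent (insert x B)" by (intro independent_insertI)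
  from p.linear_independent_extend[OF this, of "\<lambda>y. if y = x then 1 else 0"]
  obtain g where g: "Vector_Spaces.linear sV (*) g" "\<forall>y\<in>insert x B. g y = (if y = x then 1 else 0)"
    by blast
  have lin: "linear_functional g"
    using p.linear_add[OF g(1)] p.linear_scale[OF g(1)] by (simp add: linear_functional_def)
  show thesis
  proof (rule that[OF lin])
    show "g x = 1" using g(2) by simp
    show "g c = 0" if "c \<in> C" for c
      by (rule linear_functional_zero_on_span[OF lin, of B]) (use g(2) B that x in auto)
  qed
qed

section \<open>Opposite modes: commutators, vacuum and conformal vector\<close>

lemma opp_commutator:
  assumes "\<And>i. i \<ge> N \<Longrightarrow> Y u (int i) v = 0"
  shows "opp v n (opp u m w) - opp u m (opp v n w) = (\<Sum>i<N. sV (of_int m gchoose i) (opp (Y u (int i) v) (m + n - int i) w))"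
proof -
  obtain I where I: "I \<ge> Suc N"
    "(\<Sum>i<I. sV ((-1) ^ i * (of_int 0 gchoose i)) (opp v (n + int i) (opp u (m + 0 - int i) w)))
    - (\<Sum>i<I. sV ((-1) powi 0 * (-1) ^ i * (of_int 0 gchoose i)) (opp u (m + int i) (opp v (n + 0 - int i) w)))
    = (\<Sum>i<I. sV (of_int m gchoose i) (opp (Y u (0 + int i) v) (m + n - int i) w))"
    using eventually_conj[OF eventually_ge_at_top[of "Suc N"]
        opp_jacobi_eventually[where u = u and v = v and l = 0 and m = m and n = n and w = w]]
    by (auto simp: eventually_sequentially)
  have "opp v n (opp u m w) - opp u m (opp v n w) = (\<Sum>i<I. sV (of_int m gchoose i) (opp (Y u (int i) v) (m + n - int i) w))"
    using I by (simp add: sum_zero_gbinomial)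
  also have "\<dots> = (\<Sum>i<N. sV (of_int m gchoose i) (opp (Y u (int i) v) (m + n - int i) w))"
    by (rule sum.mono_neutral_right) (use I(1) assms in auto)
  finally show ?thesis .
qed

lemma opp_quasi_primary:
  assumes "x \<in> wspace k" "Y \<omega> 2 x = 0"
  shows "opp x n w = sV ((-1) powi k) (Y x (2 * k - 2 - n) w)"
proof -
  have E: "L1_div (Suc j) x = 0" for j
    by (induction j) (simp_all add: L1_div_Suc assms(2) del: of_nat_Suc)
  \<comment> \<open>The range is extended by one to ensure that it contains \<open>j = 0\<close>,
    the only term that survives.\<close>
  have "opp x n w = sV ((-1) powi k) (\<Sum>j<Suc (nat (k - weight_bound + 1)). Y (L1_div j x) (2 * k - 2 - n - int j) w)"
    by (rule opp_homogeneous[OF assms(1)]) simp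
  also have "\<dots> = sV ((-1) powi k) (Y x (2 * k - 2 - n) w)"
    by (subst sum.lessThan_Suc_shift) (simp add: E)
  finally show ?thesis .
qed

lemma opp_vac: "opp vac n w = (if n = -1 then w else 0)"
proof -
  have "vac \<in> wspace 0" using vac_weight by (simp add: wspace_def)
  then have "opp vac n w = Y vac (- 2 - n) w"
    using opp_quasi_primary[of vac 0 n w] creation(1)[of 2 \<omega>] by simp
  then show ?thesis by (simp add: Y_vac)
qed

text \<open>L(1) kills \<open>\<omega>\<close>, which is L(-2) applied to the vacuum: the commutator
  of L(1) and L(-2) is a multiple of L(-1), and both L(1) and L(-1) kill the vacuum. Hence L(0) acts
  on functionals by transposition.\<close>

lemma opp_conformal: "opp \<omega> 1 w = Y \<omega> 1 w"
proof -
  have "Y \<omega> 2 \<omega> = 0"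
    using virasoro_commutator[of 2 "-1" vac] creation(1)[of 2 \<omega>] creation(1)[of 0 \<omega>] creation(2)[of \<omega>]
    by simp
  moreover have "\<omega> \<in> wspace 2" using conformal_weight by (simp add: wspace_def)
  ultimately show ?thesis using opp_quasi_primary[of \<omega> 2 1 w] by simp
qed

section \<open>The weak module of functionals with truncation\<close>

definition dual_action :: "'v \<Rightarrow> int \<Rightarrow> ('v \<Rightarrow> complex) \<Rightarrow> 'v \<Rightarrow> complex"
  where "dual_action v n f = (\<lambda>w. f (opp v n w))"

text \<open>The bound \<open>N\<close> is uniform in the argument of the functional, since the
  equation is one between functions.\<close>

definition dual_module :: "('v \<Rightarrow> complex) set"
  where "dual_module = {f. linear_functional f \<and> (\<forall>v. \<exists>N. \<forall>n\<ge>N. dual_action v n f = 0)}"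

lemma dual_action_linear: "linear_functional f \<Longrightarrow> linear_functional (dual_action v n f)"
  by (simp add: linear_functional_def dual_action_def opp_add_right opp_scale_right)

lemma dual_action_add: "dual_action v n (f + g) = dual_action v n f + dual_action v n g"
  and dual_action_scale: "dual_action v n (fun_scale c f) = fun_scale c (dual_action v n f)"
  by (simp_all add: dual_action_def fun_scale_def fun_eq_iff)

lemma dual_action_zero [simp]: "dual_action v n 0 = 0"
  by (simp add: dual_action_def fun_eq_iff)

lemma dual_action_add_left:
  "linear_functional f \<Longrightarrow> dual_action (u + v) n f = dual_action u n f + dual_action v n f"
  by (simp add: dual_action_def fun_eq_iff opp_add linear_functional_add)

lemma dual_action_scale_left:
  "linear_functional f \<Longrightarrow> dual_action (sV c v) n f = fun_scale c (dual_action v n f)"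
  by (simp add: dual_action_def fun_scale_def fun_eq_iff opp_scale linear_functional_scale)

lemma dual_action_zero_left [simp]: "linear_functional f \<Longrightarrow> dual_action 0 n f = 0"
  by (simp add: dual_action_def fun_eq_iff linear_functional_zero)

lemma fun_scale_zero [simp]: "fun_scale c 0 = 0"
  by (simp add: fun_scale_def fun_eq_iff)

lemma eventually_dual_action_zero:
  assumes "f \<in> dual_module"
  shows "\<forall>\<^sub>F i in sequentially. dual_action v (n + int i) f = 0"
proof -
  obtain N where "\<forall>n\<ge>N. dual_action v n f = 0" using assms by (auto simp: dual_module_def)
  then show ?thesis
    by (auto simp: eventually_sequentially intro!: exI[of _ "nat (N - n)"])
qed

text \<open>The commutator formula interchanges the actions of \<open>v\<close> and
  \<open>u\<close>. The interchanged term and the finitely many commutator terms all contain a mode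
  acting directly on \<open>f\<close> that kills it for large \<open>n\<close>.\<close>

lemma dual_module_closed:
  assumes f: "f \<in> dual_module"
  shows "dual_action u m f \<in> dual_module"
proof -
  have lin: "linear_functional f" using f by (simp add: dual_module_def)
  have "\<exists>N. \<forall>n\<ge>N. dual_action v n (dual_action u m f) = 0" for v
  proof -
    obtain I where I: "\<And>i. i \<ge> I \<Longrightarrow> Y u (int i) v = 0"
      using eventually_Y_zero[of u 0 v] by (auto simp: eventually_sequentially)
    obtain A where A: "\<And>n. n \<ge> A \<Longrightarrow> dual_action v n f = 0"
      using f unfolding dual_module_def by blast
    have "\<forall>x. \<exists>N. \<forall>n\<ge>N. dual_action x n f = 0" using f unfolding dual_module_def by blast
    then obtain N where N: "\<And>x n. n \<ge> N x \<Longrightarrow> dual_action x n f = 0" by metis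
\<comment> \<open>All indices \<open>m + n - i\<close> with \<open>i < I\<close> must reach the
  bounds \<open>N\<close>, hence the offset \<open>I - m\<close>; adjoining 0 keeps
  \<open>Max\<close> defined when \<open>I = 0\<close>.\<close>
have "dual_action v n (dual_action u m f) = 0" if n: "n \<ge> max A (Max ((\<lambda>i. N (Y u (int i) v)) ` {..<I} \<union> {0}) + int I - m)" for n
    proof
      fix w
      have nA: "f (opp v n (opp u m w)) = 0"
        using A[of n] n by (simp add: dual_action_def fun_eq_iff)
      have *: "f (opp (Y u (int i) v) (m + n - int i) w) = 0" if i: "i < I" for i
      proof -
        have "N (Y u (int i) v) \<le> Max ((\<lambda>i. N (Y u (int i) v)) ` {..<I} \<union> {0})"
          by (rule Max_ge) (use i in auto)
        then have "N (Y u (int i) v) \<le> m + n - int i" using n i by linarith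
        from N[OF this] show ?thesis by (simp add: dual_action_def fun_eq_iff)
      qed
      have "opp v n (opp u m w) - opp u m (opp v n w)
          = (\<Sum>i<I. sV (of_int m gchoose i) (opp (Y u (int i) v) (m + n - int i) w))"
        by (rule opp_commutator) (rule I)
      from arg_cong[OF this, of f] have "f (opp v n (opp u m w)) - f (opp u m (opp v n w)) = 0"
        using *
        by (simp add: linear_functional_diff[OF lin] linear_functional_sum[OF lin] linear_functional_scale[OF lin])
      then show "dual_action v n (dual_action u m f) w = 0 w"
        using nA by (simp add: dual_action_def)
    qed
    then show ?thesis by blast
  qed
  then show ?thesis using dual_action_linear[OF lin] by (simp add: dual_module_def)
qed

lemma dual_jacobi: "jacobi_identity Y fun_scale dual_module dual_action"
  unfolding jacobi_identity_def
proof (intro allI ballI)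
  fix u v f and l m n :: int
  assume f: "f \<in> dual_module"
  then have lin: "linear_functional f" by (simp add: dual_module_def)
  define F1 where "F1 i = fun_scale ((-1) ^ i * (of_int l gchoose i)) (dual_action u (m + l - int i) (dual_action v (n + int i) f))" for i
  define F2 where "F2 i = fun_scale ((-1) powi l * (-1) ^ i * (of_int l gchoose i)) (dual_action v (n + l - int i) (dual_action u (m + int i) f))" for i
  define F3 where "F3 i = fun_scale (of_int m gchoose i) (dual_action (Y u (l + int i) v) (m + n - int i) f)" for i
  have ev: "\<forall>\<^sub>F I in sequentially. Sum_any F = sum F {..<I}"
    if "\<forall>\<^sub>F i in sequentially. F i = 0" for F :: "nat \<Rightarrow> 'v \<Rightarrow> complex"
    using that eventually_Sum_any_eq_sum[of _ F] unfolding eventually_sequentially by blast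
  have F1: "\<forall>\<^sub>F I in sequentially. Sum_any F1 = sum F1 {..<I}"
    by (rule ev, use eventually_dual_action_zero[OF f, of v n] in eventually_elim) (simp add: F1_def)
  have F2: "\<forall>\<^sub>F I in sequentially. Sum_any F2 = sum F2 {..<I}"
    by (rule ev, use eventually_dual_action_zero[OF f, of u m] in eventually_elim) (simp add: F2_def)
  have F3: "\<forall>\<^sub>F I in sequentially. Sum_any F3 = sum F3 {..<I}"
    by (rule ev, use eventually_Y_zero[of u l v] in eventually_elim) (simp add: F3_def lin)
  have "Sum_any F1 - Sum_any F2 = Sum_any F3"
  proof
    \<comment> \<open>The cutoff in the opposite Jacobi identity depends on \<open>w\<close>, so the
      identity of functionals is verified pointwise.\<close>
    fix w
    have "\<forall>\<^sub>F I in sequentially. (Sum_any F1 - Sum_any F2) w = Sum_any F3 w"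
      using F1 F2 F3 opp_jacobi_eventually[where u = u and v = v and l = l and m = m and n = n and w = w]
    proof eventually_elim
      case (elim I)
      from arg_cong[OF elim(4), of f] show ?case
        unfolding elim(1-3)
        by (simp add: sum_fun_apply linear_functional_diff[OF lin] linear_functional_sum[OF lin]
            linear_functional_scale[OF lin] F1_def F2_def F3_def fun_scale_def dual_action_def)
    qed
    then show "(Sum_any F1 - Sum_any F2) w = Sum_any F3 w" by simp
  qed
  then show "Sum_any (\<lambda>i. fun_scale ((-1) ^ i * (of_int l gchoose i)) (dual_action u (m + l - int i) (dual_action v (n + int i) f)))
    - Sum_any (\<lambda>i. fun_scale ((-1) powi l * (-1) ^ i * (of_int l gchoose i)) (dual_action v (n + l - int i) (dual_action u (m + int i) f)))
    = Sum_any (\<lambda>i. fun_scale (of_int m gchoose i) (dual_action (Y u (l + int i) v) (m + n - int i) f))"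
    by (simp add: F1_def F2_def F3_def)
qed

lemma dual_weak_module: "weak_module sV Y vac \<omega> fun_scale dual_module dual_action"
proof -
  interpret F: vector_space "fun_scale :: complex \<Rightarrow> ('v \<Rightarrow> complex) \<Rightarrow> 'v \<Rightarrow> complex"
    by (rule vector_space_fun_scale)
  have lin: "linear_functional f" if "f \<in> dual_module" for f
    using that by (simp add: dual_module_def)
  have sub: "F.subspace dual_module"
  proof (rule F.subspaceI)
    show "0 \<in> dual_module" by (simp add: dual_module_def linear_functional_def)
    show "f + g \<in> dual_module" if f: "f \<in> dual_module" and g: "g \<in> dual_module" for f g
    proof -
      have "\<exists>N. \<forall>n\<ge>N. dual_action v n (f + g) = 0" for v
      proof -
        obtain A B where "\<forall>n\<ge>A. dual_action v n f = 0" "\<forall>n\<ge>B. dual_action v n g = 0"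
          using f g unfolding dual_module_def by blast
        then have "\<forall>n\<ge>max A B. dual_action v n (f + g) = 0" by (simp add: dual_action_add)
        then show ?thesis by blast
      qed
      then show ?thesis
        using lin[OF f] lin[OF g] by (simp add: dual_module_def linear_functional_def algebra_simps)
    qed
    show "fun_scale c f \<in> dual_module" if f: "f \<in> dual_module" for c f
    proof -
      have "\<exists>N. \<forall>n\<ge>N. dual_action v n (fun_scale c f) = 0" for v
        using f unfolding dual_module_def dual_action_scale by (auto, metis fun_scale_zero)
      then show ?thesis
        using lin[OF f] by (simp add: dual_module_def linear_functional_def fun_scale_def algebra_simps)
    qed
  qed
  have "vertex_action sV Y vac fun_scale dual_module dual_action"
    unfolding vertex_action_def
  proof (intro conjI allI ballI)
    fix f n assume "f \<in> dual_module"
    then show "dual_action vac n f = (if n = - 1 then f else 0)"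
      using linear_functional_zero[OF lin] by (auto simp: dual_action_def opp_vac fun_eq_iff)
  next
    fix v f assume "f \<in> dual_module"
    then show "\<exists>N. \<forall>n\<ge>N. dual_action v n f = 0" by (simp add: dual_module_def)
  qed (simp_all add: dual_module_closed dual_action_add dual_action_scale dual_action_add_left
      dual_action_scale_left lin dual_jacobi)
  with sub show ?thesis
    by unfold_locales
qed

section \<open>Supports of functionals spanned by L(0)-eigenvectors\<close>

lemma dual_eigenvector_finite_support:
  assumes "f \<in> L0_eigenspace fun_scale dual_module dual_action \<omega> h"
  shows "finite {n. \<exists>x\<in>wspace n. f x \<noteq> 0}"
proof -
  have lin: "linear_functional f" and eig: "dual_action \<omega> 1 f = fun_scale h f"
    using assms by (simp_all add: L0_eigenspace_def Lop_def dual_module_def)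
  \<comment> \<open>On a vector of weight \<open>n\<close> the eigenvalue equation reads n f(x) = h
    f(x).\<close>
  have "of_int n = h" if "x \<in> wspace n" "f x \<noteq> 0" for n x
    using fun_cong[OF eig, of x] that linear_functional_scale[OF lin]
    by (simp add: dual_action_def fun_scale_def opp_conformal wspace_iff)
  then have "{n. \<exists>x\<in>wspace n. f x \<noteq> 0} \<subseteq> of_int -` {h}" by auto
  moreover have "finite (of_int -` {h} :: int set)"
    by (rule finite_vimageI) (simp_all add: inj_on_def)
  ultimately show ?thesis by (rule finite_subset)
qed

lemma finite_support_if_spanned:
  assumes "f \<in> module.span fun_scale (\<Union>h. L0_eigenspace fun_scale dual_module dual_action \<omega> h)"
  shows "finite {n. \<exists>x\<in>wspace n. f x \<noteq> 0}"
proof -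
  interpret F: vector_space "fun_scale :: complex \<Rightarrow> ('v \<Rightarrow> complex) \<Rightarrow> 'v \<Rightarrow> complex"
    by (rule vector_space_fun_scale)
  show ?thesis
    using assms
  proof (induction rule: F.span_induct_alt)
    case base
    then show ?case by simp
  next
    case (step c f g)
    have "{n. \<exists>x\<in>wspace n. (fun_scale c f + g) x \<noteq> 0}
        \<subseteq> {n. \<exists>x\<in>wspace n. f x \<noteq> 0} \<union> {n. \<exists>x\<in>wspace n. g x \<noteq> 0}"
      by (auto simp: fun_scale_def)
    moreover have "finite {n. \<exists>x\<in>wspace n. f x \<noteq> 0}"
      using step(1) dual_eigenvector_finite_support by blast
    ultimately show ?case using step(2) finite_subset by blast
  qed
qed

lemma class_A_finite_support:
  assumes "class_A sV Y vac \<omega>" "f \<in> dual_module"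
  shows "finite {n. \<exists>x\<in>wspace n. f x \<noteq> 0}"
proof (rule finite_support_if_spanned)
  have "L0_semisimple fun_scale dual_module dual_action \<omega>"
    using assms(1) dual_weak_module unfolding class_A_def by blast
  then show "f \<in> module.span fun_scale (\<Union>h. L0_eigenspace fun_scale dual_module dual_action \<omega> h)"
    using assms(2) by (simp add: L0_semisimple_def direct_sum_def)
qed

text \<open>Eigenvectors in a summand are eigenvectors in \<open>dual_module\<close>, so every
  summand, being spanned by its own eigenvectors, lies in the span of all of them.\<close>

lemma regular_finite_support:
  assumes "regular sV Y vac \<omega>" "f \<in> dual_module"
  shows "finite {n. \<exists>x\<in>wspace n. f x \<noteq> 0}"
proof (rule finite_support_if_spanned)
  interpret F: vector_space "fun_scale :: complex \<Rightarrow> ('v \<Rightarrow> complex) \<Rightarrow> 'v \<Rightarrow> complex"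
    by (rule vector_space_fun_scale)
  let ?E = "\<lambda>M. \<Union>h. L0_eigenspace fun_scale M dual_action \<omega> h"
  obtain \<S> where S: "direct_sum fun_scale dual_module \<S> (\<lambda>M. M)"
    and ord: "\<And>M. M \<in> \<S> \<Longrightarrow> ordinary_module sV Y vac \<omega> fun_scale M dual_action"
    using assms(1) dual_weak_module unfolding regular_def by blast
  have span: "F.span (\<Union>M\<in>\<S>. M) = dual_module"
    using S by (simp add: direct_sum_def)
  have "M \<subseteq> F.span (?E dual_module)" if M: "M \<in> \<S>" for M
  proof -
    interpret M: ordinary_module sV Y vac \<omega> fun_scale M dual_action by (rule ord[OF M])
    have "M \<subseteq> F.span (\<Union>M\<in>\<S>. M)"
      by (rule order_trans[OF _ F.span_superset]) (use M in blast)
    then have "M \<subseteq> dual_module" by (simp only: span)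
    then have "?E M \<subseteq> ?E dual_module" by (auto simp: L0_eigenspace_def)
    moreover have "F.span (?E M) = M" using M.module_grading by (simp add: direct_sum_def)
    ultimately show ?thesis using F.span_mono by metis
  qed
  then have "F.span (\<Union>M\<in>\<S>. M) \<subseteq> F.span (?E dual_module)"
    by (intro F.span_minimal F.subspace_span) auto
  then show "f \<in> F.span (?E dual_module)" using assms(2) span by blast
qed

section \<open>Finiteness\<close>

definition Cspace :: "int \<Rightarrow> 'v set"
  where "Cspace k = span {Y u (- k) v | u v. True}"

lemma Cspace_2: "C2 sV Y = Cspace 2"
  by (simp add: C2_def Cspace_def)

text \<open>By the derivative property, the mode \<open>n - 1\<close> of \<open>u\<close> is -1/n
  times the mode \<open>n\<close> of L(-1)u. Since \<open>k \<ge> 1\<close>, no division by zero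
  occurs while descending from \<open>- k\<close>.\<close>

lemma Y_in_Cspace:
  assumes "k \<ge> 1" "n \<le> - k"
  shows "Y u n v \<in> Cspace k"
proof -
  have "Y u (- k - int p) v \<in> Cspace k" for p u
  proof (induction p arbitrary: u)
    case 0
    show ?case by (auto simp: Cspace_def intro: span_base)
  next
    case (Suc p)
    have "Y (Y \<omega> 0 u) (- k - int p) v = sV (of_int (k + int p)) (Y u (- k - int (Suc p)) v)"
      using L_minus_1[of u "- k - int p" v] by (simp add: algebra_simps)
    moreover have "(of_int (k + int p) :: complex) \<noteq> 0"
      using assms(1) by (simp only: of_int_eq_0_iff)
    ultimately have "Y u (- k - int (Suc p)) v = sV (1 / of_int (k + int p)) (Y (Y \<omega> 0 u) (- k - int p) v)"
      by simp
    then show ?case using Suc[of "Y \<omega> 0 u"] span_scale by (simp add: Cspace_def)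
  qed
  from this[of u "nat (- k - n)"] show ?thesis using assms(2) by simp
qed

lemma annihilator_Cspace_in_dual:
  assumes k: "k \<ge> 1" and f: "linear_functional f" "\<And>c. c \<in> Cspace k \<Longrightarrow> f c = 0"
  shows "f \<in> dual_module"
proof -
  have "\<exists>N. \<forall>n\<ge>N. dual_action v n f = 0" for v
  proof (induction v rule: homogeneous_induct)
    case (homogeneous a x)
    \<comment> \<open>The bound on \<open>n\<close> makes every mode
      \<open>2 * a - 2 - n - j\<close> at most \<open>- k\<close>, so each term lies in
      \<open>Cspace k\<close>.\<close>
    have "f (opp x n w) = 0" if n: "n \<ge> 2 * a - 2 + k" for n w
    proof -
      have "f (Y (L1_div j x) (2 * a - 2 - n - int j) w) = 0" for j
        by (intro f(2) Y_in_Cspace k) (use n in linarith)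
      then show ?thesis
        by (simp add: opp_homogeneous[OF homogeneous order_refl] linear_functional_scale[OF f(1)]
            linear_functional_sum[OF f(1)])
    qed
    then have "\<forall>n\<ge>2 * a - 2 + k. dual_action x n f = 0" by (simp add: dual_action_def fun_eq_iff)
    then show ?case by blast
  next
    case (add x y)
    then obtain A B where "\<forall>n\<ge>A. dual_action x n f = 0" "\<forall>n\<ge>B. dual_action y n f = 0" by blast
    then have "\<forall>n\<ge>max A B. dual_action (x + y) n f = 0" by (simp add: dual_action_add_left[OF f(1)])
    then show ?case by blast
  qed
  then show ?thesis using f(1) by (simp add: dual_module_def)
qed

text \<open>Splitting \<open>u\<close> and \<open>v\<close> into homogeneous parts shows that
  \<open>Cspace k\<close> is graded. The weights of the factors are recorded for the induction on
  weight that yields finite generation.\<close>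

lemma proj_Cspace:
  assumes "c \<in> Cspace k"
  shows "proj n c \<in> span {Y u (- k) v | u v a b. u \<in> wspace a \<and> v \<in> wspace b \<and> a + b + k - 1 = n}"
    (is "_ \<in> span ?T")
proof -
  have proj0: "proj n 0 = 0" using proj_homogeneous[of 0 n n] by simp
  have Y: "proj n (Y u (- k) v) \<in> span ?T" for u v
  proof (induction u rule: homogeneous_induct)
    case u: (homogeneous a u)
    show ?case
    proof (induction v rule: homogeneous_induct)
      case (homogeneous b v)
      show ?case
      proof (cases "a + b + k - 1 = n")
        case True
        then have "Y u (- k) v \<in> ?T" using u homogeneous by blast
        moreover have "proj n (Y u (- k) v) = Y u (- k) v"
          using proj_homogeneous[OF wspace_Y[OF u homogeneous, of "- k"], of n] True by simp
        ultimately show ?thesis by (simp only: span_base)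
      next
        case False
        then show ?thesis
          using proj_homogeneous[OF wspace_Y[OF u homogeneous, of "- k"], of n] span_zero by simp
      qed
    next
      case (add x y)
      then show ?case by (simp add: Y_add_right proj_add span_add)
    qed
  next
    case (add x y)
    then show ?case by (simp add: Y_add_left proj_add span_add)
  qed
  show ?thesis
    using assms unfolding Cspace_def
  proof (induction rule: span_induct_alt)
    case base
    then show ?case by (simp add: proj0 span_zero)
  next
    case (step c x y)
    then show ?case using Y by (auto simp: proj_add proj_scale intro!: span_add span_scale)
  qed
qed

lemma proj_Cspace_subset: "c \<in> Cspace k \<Longrightarrow> proj n c \<in> Cspace k"
  using proj_Cspace[of c k n] unfolding Cspace_def by (rule subsetD[OF span_mono, rotated]) auto

lemma almost_all_wspace_subset_Cspace:
  assumes k: "k \<ge> 1"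
    and fin: "\<And>f. f \<in> dual_module \<Longrightarrow> finite {n. \<exists>x\<in>wspace n. f x \<noteq> 0}"
  shows "finite {n. \<not> wspace n \<subseteq> Cspace k}"
proof -
  define A where "A = {n. \<not> wspace n \<subseteq> Cspace k}"
  have "\<exists>x g. n \<in> A \<longrightarrow> x \<in> wspace n \<and> linear_functional g \<and> (\<forall>c\<in>Cspace k. g c = 0) \<and> g x = 1" for n
  proof (cases "n \<in> A")
    case True
    then obtain x where x: "x \<in> wspace n" "x \<notin> Cspace k" by (auto simp: A_def)
    have "subspace (Cspace k)" by (simp add: Cspace_def)
    from separating_functional[OF this x(2)] x(1) show ?thesis by metis
  qed simp
  then obtain x g where xg: "\<And>n. n \<in> A \<Longrightarrow> x n \<in> wspace n" "\<And>n. n \<in> A \<Longrightarrow> linear_functional (g n)"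
    "\<And>n c. n \<in> A \<Longrightarrow> c \<in> Cspace k \<Longrightarrow> g n c = 0" "\<And>n. n \<in> A \<Longrightarrow> g n (x n) = 1"
    by metis
  \<comment> \<open>Possibly infinitely many \<open>g n\<close> are glued together; each
    \<open>v\<close> has only finitely many nonzero components, so the sum is finite.\<close>
  define f where "f v = (\<Sum>n | n \<in> A \<and> proj n v \<noteq> 0. g n (proj n v))" for v
  have f_eq: "f v = (\<Sum>n\<in>B. g n (proj n v))"
    if "finite B" "B \<subseteq> A" "{n. n \<in> A \<and> proj n v \<noteq> 0} \<subseteq> B" for v B
    unfolding f_def
    by (rule sum.mono_neutral_left) (use that xg(2) linear_functional_zero in \<open>auto simp: subset_eq\<close>)
  have finA: "finite {n. n \<in> A \<and> proj n v \<noteq> 0}" for v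
    by (rule finite_subset[OF _ finite_proj[of v]]) auto
  have lin: "linear_functional f"
    unfolding linear_functional_def
  proof (intro conjI allI)
    fix v w
    let ?B = "{n. n \<in> A \<and> proj n v \<noteq> 0} \<union> {n. n \<in> A \<and> proj n w \<noteq> 0}"
    have "f z = (\<Sum>n\<in>?B. g n (proj n z))" if "z \<in> {v, w, v + w}" for z
      by (rule f_eq) (use that finA in \<open>auto simp: proj_add\<close>)
    then show "f (v + w) = f v + f w"
      by (simp add: proj_add sum.distrib[symmetric]) (auto intro!: sum.cong simp: linear_functional_add[OF xg(2)])
  next
    fix c v
    have "f (sV c v) = (\<Sum>n | n \<in> A \<and> proj n v \<noteq> 0. g n (proj n (sV c v)))"
      by (rule f_eq) (use finA in \<open>auto simp: proj_scale\<close>)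
    also have "\<dots> = c * f v"
      unfolding f_def sum_distrib_left by (rule sum.cong) (simp_all add: proj_scale linear_functional_scale[OF xg(2)])
    finally show "f (sV c v) = c * f v" .
  qed
  \<comment> \<open>Because \<open>Cspace k\<close> is graded, each component of \<open>c\<close>
    lies in it and is killed by the corresponding \<open>g n\<close>.\<close>
  have "f c = 0" if "c \<in> Cspace k" for c
    unfolding f_def by (rule sum.neutral) (use xg(3) proj_Cspace_subset[OF that] in auto)
  with lin have "f \<in> dual_module" by (rule annihilator_Cspace_in_dual[OF k])
  moreover have "f (x n) = 1" if "n \<in> A" for n
  proof -
    have proj: "proj i (x n) = (if i = n then x n else 0)" for i
      by (rule proj_homogeneous[OF xg(1)[OF that]])
    have "f (x n) = (\<Sum>i\<in>{n}. g i (proj i (x n)))"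
      by (rule f_eq) (use that in \<open>auto simp: proj\<close>)
    then show ?thesis by (simp add: proj xg(4)[OF that])
  qed
  then have "A \<subseteq> {n. \<exists>x\<in>wspace n. f x \<noteq> 0}" using xg(1) by force
  ultimately show ?thesis using fin finite_subset unfolding A_def by blast
qed

section \<open>Finiteness of the quotient by \<open>Cspace 2\<close>\<close>

lemma finite_complement_Cspace:
  assumes "finite {n. \<not> wspace n \<subseteq> Cspace k}"
  obtains B where "finite B" "\<And>n. \<not> wspace n \<subseteq> Cspace k \<Longrightarrow> wspace n \<subseteq> span B"
proof -
  have "\<forall>n. \<exists>B. finite B \<and> span B = wspace n"
    using finite_dim_weight_spaces by (simp add: finite_dim_def wspace_def)
  then obtain b where b: "\<And>n. finite (b n)" "\<And>n. span (b n) = wspace n" by metis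
  show thesis
  proof
    let ?B = "\<Union>n\<in>{n. \<not> wspace n \<subseteq> Cspace k}. b n"
    show "finite ?B" using assms b(1) by blast
    show "wspace n \<subseteq> span ?B" if "\<not> wspace n \<subseteq> Cspace k" for n
      using span_mono[of "b n" ?B] b(2)[of n] that by blast
  qed
qed

lemma C2_finite_if:
  assumes "finite {n. \<not> wspace n \<subseteq> Cspace 2}"
  shows "C2_finite sV Y"
proof -
  obtain B where B: "finite B" "\<And>n. \<not> wspace n \<subseteq> Cspace 2 \<Longrightarrow> wspace n \<subseteq> span B"
    using finite_complement_Cspace[OF assms] by blast
  have sub: "subspace (Cspace 2)" by (simp add: Cspace_def)
  \<comment> \<open>The finitely many exceptional weight spaces lie in \<open>span B\<close> and the
    others in \<open>Cspace 2\<close>, so the two subspaces together span everything.\<close>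
  have dec: "\<exists>b\<in>span B. v - b \<in> Cspace 2" for v
  proof (induction v rule: homogeneous_induct)
    case (homogeneous n x)
    show ?case
    proof (cases "wspace n \<subseteq> Cspace 2")
      case True
      then show ?thesis using homogeneous span_zero by (intro bexI[of _ 0]) auto
    next
      case False
      then show ?thesis using homogeneous B(2) subspace_0[OF sub] by (intro bexI[of _ x]) auto
    qed
  next
    case (add x y)
    then obtain b b' where "b \<in> span B" "x - b \<in> Cspace 2" "b' \<in> span B" "y - b' \<in> Cspace 2" by blast
    then show ?case
      using subspace_add[OF sub, of "x - b" "y - b'"] span_add
      by (intro bexI[of _ "b + b'"]) (auto simp: algebra_simps)
  qed
  have coset: "(+) v ` Cspace 2 = (+) b ` Cspace 2" if "v - b \<in> Cspace 2" for v b
  proof -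
    have "(+) v ` Cspace 2 = (+) b ` ((+) (v - b) ` Cspace 2)"
      by (simp add: image_image algebra_simps)
    also have "(+) (v - b) ` Cspace 2 = Cspace 2"
    proof
      show "(+) (v - b) ` Cspace 2 \<subseteq> Cspace 2" using that subspace_add[OF sub] by blast
      show "Cspace 2 \<subseteq> (+) (v - b) ` Cspace 2"
      proof
        fix x assume "x \<in> Cspace 2"
        then have "x - (v - b) \<in> Cspace 2" using that subspace_diff[OF sub] by blast
        moreover have "x = (v - b) + (x - (v - b))" by simp
        ultimately show "x \<in> (+) (v - b) ` Cspace 2" by blast
      qed
    qed
    finally show ?thesis .
  qed
  have "range (\<lambda>v. (+) v ` Cspace 2) = (\<lambda>v. (+) v ` Cspace 2) ` span B"
  proof
    show "range (\<lambda>v. (+) v ` Cspace 2) \<subseteq> (\<lambda>v. (+) v ` Cspace 2) ` span B"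
    proof clarify
      fix v
      obtain b where "b \<in> span B" "v - b \<in> Cspace 2" using dec by blast
      then show "(+) v ` Cspace 2 \<in> (\<lambda>v. (+) v ` Cspace 2) ` span B" using coset by blast
    qed
  qed auto
  then show ?thesis
    using B(1) unfolding C2_finite_def finite_dim_quotient_def Cspace_2 by blast
qed

section \<open>Finite generation\<close>

definition generated :: "'v set \<Rightarrow> 'v set"
  where "generated S = span {foldr (\<lambda>(u, n) w. Y u n w) us vac | us. fst ` set us \<subseteq> S}"

lemma subspace_generated: "subspace (generated S)"
  by (simp add: generated_def)

lemma vac_generated: "vac \<in> generated S"
  unfolding generated_def by (rule span_base) (auto intro!: exI[of _ "[]"])

lemma Y_generator:
  assumes "s \<in> S" "w \<in> generated S"
  shows "Y s n w \<in> generated S"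
  using assms(2) unfolding generated_def
proof (induction rule: span_induct_alt)
  case base
  then show ?case by (simp add: span_zero)
next
  case (step c x y)
  then obtain us where us: "x = foldr (\<lambda>(u, n) w. Y u n w) us vac" "fst ` set us \<subseteq> S" by blast
  then have "Y s n x = foldr (\<lambda>(u, n) w. Y u n w) ((s, n) # us) vac" "fst ` set ((s, n) # us) \<subseteq> S"
    using assms(1) by simp_all
  then have "Y s n x \<in> span {foldr (\<lambda>(u, n) w. Y u n w) us vac | us. fst ` set us \<subseteq> S}"
    by (intro span_base) blast
  then show ?case using step by (simp add: Y_add_right Y_scale_right span_add span_scale)
qed

lemma generator_in_generated: "s \<in> S \<Longrightarrow> s \<in> generated S"
  using Y_generator[of s S vac "-1"] vac_generated creation(2) by simp

text \<open>Induction on the word representing \<open>u\<close>: the iterate formula expresses a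
  mode of \<open>Y s l v\<close> through modes of the generator \<open>s\<close> and of the shorter
  word \<open>v\<close>, which preserve \<open>generated S\<close>.\<close>

lemma Y_generated:
  assumes "u \<in> generated S" "w \<in> generated S"
  shows "Y u n w \<in> generated S"
proof -
  have mono: "\<forall>n. \<forall>w\<in>generated S. Y (foldr (\<lambda>(u, n) w. Y u n w) us vac) n w \<in> generated S"
    if "fst ` set us \<subseteq> S" for us
    using that
  proof (induction us)
    case Nil
    then show ?case using subspace_0[OF subspace_generated] by (simp add: Y_vac)
  next
    case (Cons a us)
    obtain s l where a: "a = (s, l)" by (cases a)
    define v where "v = foldr (\<lambda>(u, n) w. Y u n w) us vac"
    have s: "s \<in> S" and v: "\<And>n w. w \<in> generated S \<Longrightarrow> Y v n w \<in> generated S"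
      using Cons a by (auto simp: v_def)
    have "Y (Y s l v) n w \<in> generated S" if "w \<in> generated S" for n w
    proof -
      obtain I where "Y (Y s l v) n w =
        (\<Sum>i<I. sV ((-1) ^ i * (of_int l gchoose i)) (Y s (l - int i) (Y v (n + int i) w)))
        - (\<Sum>i<I. sV ((-1) powi l * (-1) ^ i * (of_int l gchoose i)) (Y v (n + l - int i) (Y s (int i) w)))"
        using iterate_formula[of s l v n w] by (auto simp: eventually_sequentially)
      then show ?thesis
        using s v that
        by (simp add: subspace_generated subspace_diff subspace_sum subspace_scale Y_generator)
    qed
    then show ?case by (simp add: a v_def)
  qed
  show ?thesis
    using assms(1) unfolding generated_def[of S]
  proof (induction rule: span_induct_alt)
    case base
    then show ?case by (simp add: span_zero)
  next
    case (step c x y)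
    then have "Y x n w \<in> generated S" using mono assms(2) by blast
    then show ?case
      using step by (simp add: Y_add_left Y_scale_left generated_def span_add span_scale)
  qed
qed

lemma finitely_generated_if:
  assumes fin: "finite {n. \<not> wspace n \<subseteq> Cspace k}" and k: "k \<ge> 2" "k \<ge> 2 - weight_bound"
  shows "finitely_generated sV Y vac"
proof -
  obtain B where B: "finite B" "\<And>n. \<not> wspace n \<subseteq> Cspace k \<Longrightarrow> wspace n \<subseteq> span B"
    using finite_complement_Cspace[OF fin] by blast
  have "span B \<subseteq> generated B"
    by (rule span_minimal[OF _ subspace_generated]) (auto intro: generator_in_generated)
  note B' = order_trans[OF B(2) this]
  have wspace: "wspace n \<subseteq> generated B" for n
  \<comment> \<open>The measure is 0 below \<open>weight_bound\<close>, where the weight spaces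
    vanish.\<close>
  proof (induction "nat (n - weight_bound + 1)" arbitrary: n rule: less_induct)
    case less
    have IH: "wspace a \<subseteq> generated B" if "a < n" for a
    proof (cases "a < weight_bound")
      case True
      then show ?thesis using wspace_below subspace_0[OF subspace_generated] by auto
    next
      case False
      then show ?thesis using less that by simp
    qed
    show ?case
    proof (cases "wspace n \<subseteq> Cspace k")
      case False
      then show ?thesis by (rule B')
    next
      case True
      show ?thesis
      proof
        fix x assume x: "x \<in> wspace n"
        then have "x \<in> span {Y u (- k) v | u v a b. u \<in> wspace a \<and> v \<in> wspace b \<and> a + b + k - 1 = n}"
          using proj_Cspace[of x k n] True by (auto simp: proj_homogeneous)
        also have "\<dots> \<subseteq> generated B"
        proof (rule span_minimal[OF _ subspace_generated], clarify)
          fix u v a b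
          assume uv: "u \<in> wspace a" "v \<in> wspace b" and n: "n = a + b + k - 1"
          show "Y u (- k) v \<in> generated B"
          proof (cases "a < weight_bound \<or> b < weight_bound")
            case True
            then have "Y u (- k) v = 0" using uv wspace_below by auto
            then show ?thesis using subspace_0[OF subspace_generated] by simp
          next
            case False
            \<comment> \<open>As \<open>b \<ge> weight_bound\<close> and
              \<open>k \<ge> 2 - weight_bound\<close>, one has
              \<open>n - a = b + k - 1 \<ge> 1\<close>; likewise for \<open>b\<close>.\<close>
            then have "a < n" "b < n" using n k by auto
            then show ?thesis using IH uv by (intro Y_generated) auto
          qed
        qed
        finally show "x \<in> generated B" .
      qed
    qed
  qed
  have "v \<in> generated B" for v
    by (induction v rule: homogeneous_induct) (use wspace subspace_add[OF subspace_generated] in blast)+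
  then have "generated B = UNIV" by blast
  then show ?thesis using B(1) unfolding finitely_generated_def generated_def by blast
qed

end

theorem theorem3p8:
  fixes sV :: "complex \<Rightarrow> 'v::ab_group_add \<Rightarrow> 'v"
    and Y :: "'v \<Rightarrow> int \<Rightarrow> 'v \<Rightarrow> 'v"
    and vac \<omega> :: 'v
  assumes "vertex_operator_algebra sV Y vac \<omega>"
  shows "(class_A sV Y vac \<omega> \<longrightarrow> C2_finite sV Y \<and> finitely_generated sV Y vac) \<and>
         (regular sV Y vac \<omega> \<longrightarrow> C2_finite sV Y \<and> finitely_generated sV Y vac)"
proof -
  interpret vertex_operator_algebra sV Y vac \<omega> by (rule assms)
  have "C2_finite sV Y \<and> finitely_generated sV Y vac"
    if fin: "\<And>f. f \<in> dual_module \<Longrightarrow> finite {n. \<exists>x\<in>wspace n. f x \<noteq> 0}"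
  proof
    show "C2_finite sV Y"
      by (rule C2_finite_if, rule almost_all_wspace_subset_Cspace) (simp_all add: fin)
    show "finitely_generated sV Y vac"
      by (rule finitely_generated_if[of "max 2 (2 - weight_bound)"], rule almost_all_wspace_subset_Cspace) (simp_all add: fin)
  qed
  then show ?thesis using class_A_finite_support regular_finite_support by blast
qed

end
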